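(* There exists a non-adaptive tolerant $L_1$-tester for monotonicity of functions $f\colon[n]^d\to[0,1]$ with query complexity (i) $\tilde{O}\!\left(\frac{1}{(\varepsilon_2-\varepsilon_1)^2}\left(\frac{5d}{\varepsilon_2-\varepsilon_1}\right)^d\right)$, for any $0\leq\varepsilon_1<\varepsilon_2\leq1$; and (ii) $2^{\tilde{O}(\sqrt{d}/(\varepsilon_2-3\varepsilon_1)^2)}$, for any $0\leq 3\varepsilon_1<\varepsilon_2\leq1$.
   Context: $[n]^d$ is ordered coordinatewise; $g\colon[n]^d\to[0,1]$ is monotone if $x\preceq y$ implies $g(x)\leq g(y)$. For $f,g\colon[n]^d\to[0,1]$, $L_1(f,g)=\mathbb{E}_{x}[|f(x)-g(x)|]$ for uniform $x\in[n]^d$, and $L_1(f,\mathcal{M})$ is the infimum of $L_1(f,g)$ over monotone $g\colon[n]^d\to[0,1]$. A tolerant $L_1$-tester for monotonicity, given $0\leq\varepsilon_1<\varepsilon_2\leq1$ and query access to $f$, accepts with probability at least $2/3$ if $L_1(f,\mathcal{M})\leq\varepsilon_1$ and rejects with probability at least $2/3$ if $L_1(f,\mathcal{M})\geq\varepsilon_2$. Non-adaptive means queries do not depend on previous answers. $\tilde{O}$ hides polylogarithmic factors. *)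

theory Defs
  imports Complex_Main "HOL-Probability.Probability_Mass_Function"
begin

text \<open>The grid [n]^d, with [n] represented as {0..<n} (order-isomorphic to {1..n}).
Points are lists of length d.\<close>
definition grid :: "nat \<Rightarrow> nat \<Rightarrow> nat list set" where
  "grid n d = {x. length x = d \<and> (\<forall>i<d. x ! i < n)}"

definition coord_le :: "nat list \<Rightarrow> nat list \<Rightarrow> bool" where
  "coord_le x y = list_all2 (\<le>) x y"

definition unit_valued :: "nat \<Rightarrow> nat \<Rightarrow> (nat list \<Rightarrow> real) \<Rightarrow> bool" where
  "unit_valued n d f = (\<forall>x\<in>grid n d. 0 \<le> f x \<and> f x \<le> 1)"

definition monotone_grid :: "nat \<Rightarrow> nat \<Rightarrow> (nat list \<Rightarrow> real) \<Rightarrow> bool" where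
  "monotone_grid n d g = (\<forall>x\<in>grid n d. \<forall>y\<in>grid n d. coord_le x y \<longrightarrow> g x \<le> g y)"

definition L1_dist :: "nat \<Rightarrow> nat \<Rightarrow> (nat list \<Rightarrow> real) \<Rightarrow> (nat list \<Rightarrow> real) \<Rightarrow> real" where
  "L1_dist n d f g = (\<Sum>x\<in>grid n d. \<bar>f x - g x\<bar>) / real (card (grid n d))"

definition L1_mono :: "nat \<Rightarrow> nat \<Rightarrow> (nat list \<Rightarrow> real) \<Rightarrow> real" where
  "L1_mono n d f = Inf {L1_dist n d f g | g. unit_valued n d g \<and> monotone_grid n d g}"

text \<open>A non-adaptive randomized algorithm: a probability distribution over pairs
(Q, D) of a query list Q (chosen independently of the answers) and a decision
rule D applied to the list of answers (True = accept).\<close>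
definition accept_prob ::
  "(nat list list \<times> (real list \<Rightarrow> bool)) pmf \<Rightarrow> (nat list \<Rightarrow> real) \<Rightarrow> real" where
  "accept_prob T f = measure_pmf.prob T {(Q, D). D (map f Q)}"

definition nonadaptive_tolerant_L1_tester ::
  "nat \<Rightarrow> nat \<Rightarrow> real \<Rightarrow> real \<Rightarrow> real \<Rightarrow> (nat list list \<times> (real list \<Rightarrow> bool)) pmf \<Rightarrow> bool" where
  "nonadaptive_tolerant_L1_tester n d eps1 eps2 q T =
    ((\<forall>(Q, D)\<in>set_pmf T. real (length Q) \<le> q \<and> set Q \<subseteq> grid n d) \<and>
     (\<forall>f. unit_valued n d f \<longrightarrow>
        (L1_mono n d f \<le> eps1 \<longrightarrow> accept_prob T f \<ge> 2/3) \<and>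
        (L1_mono n d f \<ge> eps2 \<longrightarrow> 1 - accept_prob T f \<ge> 2/3)))"

end

theory Submission
  imports Defs "HOL-Probability.Hoeffding" "HOL-Probability.Product_PMF"
begin

text \<open>
  Both testers sample points uniformly and accept iff some member of a fixed finite net \<open>N\<close> of
  monotone functions has small empirical distance to \<open>f\<close>. By Hoeffding and a union bound over \<open>N\<close>,
  \<open>O(ln |N| / \<epsilon>\<^sup>2)\<close> queries suffice, so everything reduces to bounding the metric entropy of the
  class of monotone functions in \<open>L\<^sub>1\<close>; no learning step is needed, and the gap
  \<open>\<epsilon>\<^sub>2 - \<epsilon>\<^sub>1 \<ge> \<epsilon>\<^sub>2 - 3 \<epsilon>\<^sub>1\<close> is enough in part (ii) as well.

  For the entropy, first round each point up to the top corner of its block in a partition into at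
  most \<open>m\<^sup>d\<close> blocks, which costs at most \<open>d / m\<close> in \<open>L\<^sub>1\<close> because a monotone function changes little
  under a diagonal shift. In the orthogonal (Efron-Stein) decomposition a
  function on the blocks has at most \<open>(1 + m)\<^sup>d\<close> coefficients, which gives (i). For (ii), a monotone
  function has total influence at most \<open>\<surd>d\<close>, so its part of degree \<open>\<ge> j\<close> has squared \<open>L\<^sub>2\<close> norm at most \<open>\<surd>d / j\<close>, while the part of smaller degree
  is described by at most \<open>(1 + d m)\<^sup>j\<close> coefficients.
\<close>

subsection \<open>Averages over the grid\<close>

lemma grid_0 [simp]: "grid n 0 = {[]}"
  by (auto simp: grid_def)

lemma grid_Suc: "grid n (Suc d) = (\<lambda>(i, x). i # x) ` ({..<n} \<times> grid n d)"
proof -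
  have "x \<in> grid n (Suc d) \<longleftrightarrow> x \<in> (\<lambda>(i, x). i # x) ` ({..<n} \<times> grid n d)" for x
    by (cases x) (auto simp: grid_def nth_Cons image_iff less_Suc_eq_0_disj split: nat.splits)
  then show ?thesis by blast
qed

lemma Cons_in_grid [simp]: "i # x \<in> grid n (Suc d) \<longleftrightarrow> i < n \<and> x \<in> grid n d"
  by (auto simp: grid_Suc)

lemma grid_SucE:
  assumes "x \<in> grid n (Suc d)"
  obtains i y where "x = i # y" "i < n" "y \<in> grid n d"
  using assms by (auto simp: grid_Suc)

lemma in_grid_iff: "x \<in> grid n d \<longleftrightarrow> length x = d \<and> (\<forall>i\<in>set x. i < n)"
  by (force simp: grid_def in_set_conv_nth)

lemma finite_grid [simp]: "finite (grid n d)"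
  by (induction d) (auto simp: grid_Suc)

lemma sum_grid_Suc: "(\<Sum>x\<in>grid n (Suc d). f x) = (\<Sum>i<n. \<Sum>x\<in>grid n d. f (i # x))"
proof -
  have "inj_on (\<lambda>(i, x). i # x) ({..<n} \<times> grid n d)"
    by (auto simp: inj_on_def)
  then show ?thesis
    by (simp add: grid_Suc sum.reindex sum.cartesian_product split_def)
qed

lemma card_grid [simp]: "card (grid n d) = n ^ d"
proof (induction d)
  case (Suc d)
  have "card (grid n (Suc d)) = (\<Sum>i<n. \<Sum>x\<in>grid n d. 1)"
    using sum_grid_Suc[where f = "\<lambda>_. 1::nat"] by simp
  with Suc show ?case by simp
qed simp

definition gmean :: "nat \<Rightarrow> nat \<Rightarrow> (nat list \<Rightarrow> real) \<Rightarrow> real" where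
  "gmean n d f = (\<Sum>x\<in>grid n d. f x) / real (n ^ d)"

definition avg :: "nat \<Rightarrow> (nat list \<Rightarrow> real) \<Rightarrow> nat list \<Rightarrow> real" where
  "avg n f x = (\<Sum>i<n. f (i # x)) / real n"

lemma L1_dist_gmean: "L1_dist n d f g = gmean n d (\<lambda>x. \<bar>f x - g x\<bar>)"
  by (simp add: L1_dist_def gmean_def)

lemma gmean_0 [simp]: "gmean n 0 f = f []"
  by (simp add: gmean_def)

lemma gmean_Suc: "gmean n (Suc d) f = (\<Sum>i<n. gmean n d (\<lambda>x. f (i # x))) / real n"
  by (simp add: gmean_def sum_grid_Suc sum_divide_distrib mult.commute)

lemma gmean_mono: "(\<And>x. x \<in> grid n d \<Longrightarrow> f x \<le> g x) \<Longrightarrow> gmean n d f \<le> gmean n d g"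
  by (simp add: gmean_def divide_right_mono sum_mono)

lemma gmean_cong: "(\<And>x. x \<in> grid n d \<Longrightarrow> f x = g x) \<Longrightarrow> gmean n d f = gmean n d g"
  by (simp add: gmean_def)

lemma gmean_add: "gmean n d (\<lambda>x. f x + g x) = gmean n d f + gmean n d g"
  by (simp add: gmean_def sum.distrib add_divide_distrib)

lemma gmean_cmult: "gmean n d (\<lambda>x. c * f x) = c * gmean n d f"
  by (simp add: gmean_def sum_distrib_left)

lemma gmean_const: "n \<ge> 1 \<Longrightarrow> gmean n d (\<lambda>_. c) = c"
  by (simp add: gmean_def)

lemma gmean_nonneg: "(\<And>x. x \<in> grid n d \<Longrightarrow> 0 \<le> f x) \<Longrightarrow> 0 \<le> gmean n d f"
  by (simp add: gmean_def sum_nonneg)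

lemma gmean_sum: "gmean n d (\<lambda>x. \<Sum>i\<in>A. f i x) = (\<Sum>i\<in>A. gmean n d (f i))"
  by (simp add: gmean_def sum.swap[of _ A] sum_divide_distrib)

lemma L1_dist_triangle: "L1_dist n d f h \<le> L1_dist n d f g + L1_dist n d g h"
  unfolding L1_dist_gmean gmean_add[symmetric] by (intro gmean_mono) linarith

lemma L1_dist_commute: "L1_dist n d f g = L1_dist n d g f"
  by (simp add: L1_dist_def abs_minus_commute)

lemma L1_dist_nonneg: "0 \<le> L1_dist n d f g"
  by (simp add: L1_dist_def sum_nonneg)

text \<open>The part of degree \<open>< j\<close> (so \<open>j = 0\<close> gives \<open>0\<close>) in the Efron-Stein decomposition: splitting
  \<open>f\<close> into its average over the first coordinate and the remainder, the latter uses up one degree.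
  The dimension is the length of the argument.\<close>
primrec lowdeg :: "nat \<Rightarrow> nat \<Rightarrow> (nat list \<Rightarrow> real) \<Rightarrow> nat list \<Rightarrow> real" where
  "lowdeg n j f [] = (if j = 0 then 0 else f [])"
| "lowdeg n j f (i # x) =
     lowdeg n j (avg n f) x + lowdeg n (j - 1) (\<lambda>y. f (i # y) - avg n f y) x"

subsection \<open>Low-degree truncation and influence\<close>

lemma avg_cong:
  "(\<And>y. y \<in> grid n (Suc d) \<Longrightarrow> f y = g y) \<Longrightarrow> x \<in> grid n d \<Longrightarrow> avg n f x = avg n g x"
  by (simp add: avg_def)

text \<open>All averages run over indices below \<open>n\<close>, so \<open>lowdeg\<close> at a grid
  point reads grid values only. The net construction uses this to replace an index by the first
  index of its block.\<close>

lemma lowdeg_cong: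
  assumes "\<And>y. y \<in> grid n d \<Longrightarrow> f y = g y" and "x \<in> grid n d"
  shows "lowdeg n j f x = lowdeg n j g x"
  using assms
proof (induction d arbitrary: j f g x)
  case (Suc d)
  from Suc.prems(2) obtain i y where x: "x = i # y" "i < n" "y \<in> grid n d"
    by (rule grid_SucE)
  have avg: "avg n f y = avg n g y" if "y \<in> grid n d" for y
    using Suc.prems(1) that by (rule avg_cong)
  have "lowdeg n j (avg n f) y = lowdeg n j (avg n g) y"
    using avg x(3) by (rule Suc.IH)
  moreover have "lowdeg n (j - 1) (\<lambda>y. f (i # y) - avg n f y) y =
      lowdeg n (j - 1) (\<lambda>y. g (i # y) - avg n g y) y"
    using x avg Suc.prems(1) by (intro Suc.IH) auto
  ultimately show ?case by (simp add: x)
qed simp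

lemma lowdeg_0: "lowdeg n 0 f x = 0"
  by (induction x arbitrary: f) simp_all

text \<open>Each coordinate uses up at most one degree, so the degree left at \<open>[]\<close> is
  still positive. Part (i) takes \<open>j = d + 1\<close>, where truncation is therefore
  exact.\<close>

lemma lowdeg_eq_self: "length x < j \<Longrightarrow> lowdeg n j f x = f x"
  by (induction x arbitrary: j f) simp_all

lemma lowdeg_diff: "lowdeg n j (\<lambda>x. f x - g x) x = lowdeg n j f x - lowdeg n j g x"
proof (induction x arbitrary: j f g)
  case (Cons i x)
  have avg: "avg n (\<lambda>x. f x - g x) = (\<lambda>x. avg n f x - avg n g x)"
    by (simp add: avg_def sum_subtractf diff_divide_distrib fun_eq_iff)
  have "(\<lambda>y. f (i # y) - g (i # y) - (avg n f y - avg n g y)) =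
      (\<lambda>y. (f (i # y) - avg n f y) - (g (i # y) - avg n g y))"
    by (simp add: fun_eq_iff)
  then show ?case by (simp add: avg Cons.IH)
qed simp

lemma lowdeg_zero: "lowdeg n j (\<lambda>_. 0) x = 0"
  using lowdeg_diff[of n j "\<lambda>_. 0" "\<lambda>_. 0" x] by simp

lemma lowdeg_sum:
  assumes "finite A"
  shows "lowdeg n j (\<lambda>x. \<Sum>i\<in>A. f i x) x = (\<Sum>i\<in>A. lowdeg n j (f i) x)"
  using assms
proof (induction A rule: finite_induct)
  case (insert a A)
  have "lowdeg n j (f a) x =
      lowdeg n j (\<lambda>x. \<Sum>i\<in>insert a A. f i x) x - lowdeg n j (\<lambda>x. \<Sum>i\<in>A. f i x) x"
    using insert.hyps by (subst lowdeg_diff[symmetric]) simp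
  then show ?case
    using insert by simp
qed (simp add: lowdeg_zero)

section \<open>Pythagoras for the average over the first coordinate\<close>

lemma sum_square_deviations:
  fixes c :: "nat \<Rightarrow> real"
  assumes "(\<Sum>i<n. c i) = real n * a"
  shows "(\<Sum>i<n. (c i)\<^sup>2) = real n * a\<^sup>2 + (\<Sum>i<n. (c i - a)\<^sup>2)"
proof -
  have "(\<Sum>i<n. (c i - a)\<^sup>2) = (\<Sum>i<n. (c i)\<^sup>2) + real n * a\<^sup>2 - (2 * a) * (\<Sum>i<n. c i)"
    by (simp add: power2_diff sum.distrib sum_subtractf sum_distrib_left mult_ac)
  then show ?thesis by (simp add: assms power2_eq_square)
qed

lemma gmean_square_deviations:
  assumes "\<And>x. x \<in> grid n d \<Longrightarrow> (\<Sum>i<n. c i x) = real n * a x"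
  shows "(\<Sum>i<n. gmean n d (\<lambda>x. (c i x)\<^sup>2)) =
    real n * gmean n d (\<lambda>x. (a x)\<^sup>2) + (\<Sum>i<n. gmean n d (\<lambda>x. (c i x - a x)\<^sup>2))"
  unfolding gmean_sum[symmetric] gmean_cmult[symmetric] gmean_add[symmetric]
  using assms by (intro gmean_cong sum_square_deviations)

lemma gmean_square_avg:
  assumes "n \<ge> 1"
  shows "gmean n (Suc d) (\<lambda>x. (f x)\<^sup>2) =
    gmean n d (\<lambda>x. (avg n f x)\<^sup>2) + (\<Sum>i<n. gmean n d (\<lambda>x. (f (i # x) - avg n f x)\<^sup>2)) / real n"
  unfolding gmean_Suc
  using assms by (subst gmean_square_deviations[where a = "avg n f"])
    (simp_all add: avg_def add_divide_distrib)

text \<open>Total influence: the mean variance along one coordinate, added up over all coordinates.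
  The first summand treats the leading coordinate, the second the remaining ones, slice by
  slice.\<close>

primrec influence :: "nat \<Rightarrow> nat \<Rightarrow> (nat list \<Rightarrow> real) \<Rightarrow> real" where
  "influence n 0 f = 0"
| "influence n (Suc d) f = (\<Sum>i<n. gmean n d (\<lambda>x. (f (i # x) - avg n f x)\<^sup>2)) / real n +
     (\<Sum>i<n. influence n d (\<lambda>x. f (i # x))) / real n"

text \<open>Influence is a nonnegative quadratic form, so a family \<open>c\<close> splits into its
  pointwise mean \<open>a\<close> and the deviations from it just as squares do. It is applied to
  the slices of a function.\<close>

lemma sum_influence:
  assumes "n \<ge> 1" and "\<And>x. (\<Sum>i<n. c i x) = real n * a x"
  shows "(\<Sum>i<n. influence n d (c i)) =
    real n * influence n d a + (\<Sum>i<n. influence n d (\<lambda>x. c i x - a x))"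
  using assms(2)
proof (induction d arbitrary: c a)
  case (Suc d)
  have n: "real n \<noteq> 0" using assms(1) by simp
  have avg_c: "(\<Sum>i<n. avg n (c i) x) = real n * avg n a x" for x
  proof -
    have "(\<Sum>i<n. avg n (c i) x) = (\<Sum>k<n. \<Sum>i<n. c i (k # x)) / real n"
      unfolding avg_def sum_divide_distrib[symmetric] by (subst sum.swap) simp
    then show ?thesis
      using n by (simp add: Suc.prems avg_def sum_distrib_left[symmetric])
  qed
  have avg_diff: "avg n (\<lambda>x. c i x - a x) x = avg n (c i) x - avg n a x" for i x
    by (simp add: avg_def sum_subtractf diff_divide_distrib)
  have V: "(\<Sum>i<n. gmean n d (\<lambda>x. (c i (k # x) - avg n (c i) x)\<^sup>2)) =
      real n * gmean n d (\<lambda>x. (a (k # x) - avg n a x)\<^sup>2) +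
      (\<Sum>i<n. gmean n d (\<lambda>x. (c i (k # x) - a (k # x) - (avg n (c i) x - avg n a x))\<^sup>2))" for k
    using gmean_square_deviations[of n d "\<lambda>i x. c i (k # x) - avg n (c i) x"
        "\<lambda>x. a (k # x) - avg n a x"]
    by (simp add: sum_subtractf Suc.prems avg_c right_diff_distrib algebra_simps)
  have I: "(\<Sum>i<n. influence n d (\<lambda>x. c i (k # x))) =
      real n * influence n d (\<lambda>x. a (k # x)) +
      (\<Sum>i<n. influence n d (\<lambda>x. c i (k # x) - a (k # x)))" for k
    using Suc.prems by (intro Suc.IH)
  \<comment> \<open>Summation over the family commutes with averaging over the leading coordinate,
    so that \<open>V\<close> and \<open>I\<close> can be used for each \<open>k\<close>
    separately.\<close>
  have exchange: "(\<Sum>i<n. influence n (Suc d) (g i)) =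
      (\<Sum>k<n. \<Sum>i<n. gmean n d (\<lambda>x. (g i (k # x) - avg n (g i) x)\<^sup>2)) / real n +
      (\<Sum>k<n. \<Sum>i<n. influence n d (\<lambda>x. g i (k # x))) / real n" for g
    unfolding influence.simps sum.distrib sum_divide_distrib[symmetric]
    by (subst (1 2) sum.swap) (rule refl)
  have "(\<Sum>i<n. influence n (Suc d) (c i)) = real n * influence n (Suc d) a +
      ((\<Sum>k<n. \<Sum>i<n. gmean n d (\<lambda>x. (c i (k # x) - a (k # x) - (avg n (c i) x - avg n a x))\<^sup>2)) / real n +
      (\<Sum>k<n. \<Sum>i<n. influence n d (\<lambda>x. c i (k # x) - a (k # x))) / real n)"
    unfolding exchange V I using n
    by (simp add: sum.distrib sum_distrib_left[symmetric] add_divide_distrib distrib_left)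
  also have "\<dots> = real n * influence n (Suc d) a + (\<Sum>i<n. influence n (Suc d) (\<lambda>x. c i x - a x))"
    unfolding exchange avg_diff ..
  finally show ?case .
qed simp

lemma influence_nonneg: "0 \<le> influence n d f"
  by (induction d arbitrary: f) (auto intro!: add_nonneg_nonneg divide_nonneg_nonneg sum_nonneg gmean_nonneg)

definition lowdeg_error :: "nat \<Rightarrow> nat \<Rightarrow> nat \<Rightarrow> (nat list \<Rightarrow> real) \<Rightarrow> real" where
  "lowdeg_error n d j f = gmean n d (\<lambda>x. (f x - lowdeg n j f x)\<^sup>2)"

text \<open>The deviations from the first-coordinate average sum to zero, hence by linearity so do
  their truncations. The error of \<open>f\<close> thus averages to the error of
  \<open>avg n f\<close>, and Pythagoras separates it from the errors of the deviations.\<close>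

lemma lowdeg_error_Suc:
  assumes "n \<ge> 1"
  shows "lowdeg_error n (Suc d) j f = lowdeg_error n d j (avg n f) +
    (\<Sum>i<n. lowdeg_error n d (j - 1) (\<lambda>x. f (i # x) - avg n f x)) / real n"
proof -
  define b where "b i x = f (i # x) - avg n f x" for i x
  define F where "F x = f x - lowdeg n j f x" for x
  have n: "real n \<noteq> 0" using assms by simp
  have "(\<Sum>i<n. b i x) = 0" for x
    using n by (simp add: b_def sum_subtractf avg_def)
  then have zero: "(\<Sum>i<n. lowdeg n (j - 1) (b i) x) = 0" for x
    using lowdeg_sum[of "{..<n}" n "j - 1" b x] by (simp add: lowdeg_zero)
  have F_Cons: "F (i # x) = (avg n f x - lowdeg n j (avg n f) x) + (b i x - lowdeg n (j - 1) (b i) x)" for i x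
    by (simp add: F_def b_def[abs_def])
  have "(\<Sum>i<n. F (i # x)) = real n * (avg n f x - lowdeg n j (avg n f) x)" for x
    unfolding F_Cons using zero \<open>(\<Sum>i<n. b i x) = 0\<close>
    by (simp add: sum.distrib sum_subtractf right_diff_distrib)
  then have avg_F: "avg n F = (\<lambda>x. avg n f x - lowdeg n j (avg n f) x)"
    using n by (simp add: avg_def[of n F] fun_eq_iff)
  show ?thesis
    using gmean_square_avg[OF assms, of d F]
    unfolding avg_F F_Cons lowdeg_error_def b_def by (simp add: F_def algebra_simps)
qed

text \<open>Truncation is an orthogonal projection, so subtracting it cannot increase the
  norm.\<close>

lemma lowdeg_error_le_square:
  assumes "n \<ge> 1"
  shows "lowdeg_error n d j f \<le> gmean n d (\<lambda>x. (f x)\<^sup>2)"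
proof (induction d arbitrary: j f)
  case (Suc d)
  show ?case
    unfolding lowdeg_error_Suc[OF assms] gmean_square_avg[OF assms]
    by (intro add_mono divide_right_mono sum_mono Suc.IH) simp
qed (simp add: lowdeg_error_def)

text \<open>Influence counts the squared norm of each component of degree k exactly k times, so the
  part of degree at least \<open>j\<close> is counted at least \<open>j\<close> times.\<close>

lemma lowdeg_error_le_influence:
  assumes "n \<ge> 1"
  shows "real j * lowdeg_error n d j f \<le> influence n d f"
proof (induction d arbitrary: j f)
  case 0
  show ?case by (simp add: lowdeg_error_def)
next
  case (Suc d)
  show ?case
  proof (cases j)
    case 0
    then show ?thesis by (simp add: influence_nonneg del: influence.simps)
  next
    case (Suc k)
    define b where "b i x = f (i # x) - avg n f x" for i x
    have n: "real n > 0" using assms by simp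
    \<comment> \<open>The deviations have used up one degree, so induction yields only the factor
      \<open>k = j - 1\<close>; the missing copy is charged to the variance along the first
      coordinate.\<close>
    have step: "real j * lowdeg_error n d k (b i) \<le> influence n d (b i) + gmean n d (\<lambda>x. (b i x)\<^sup>2)" for i
      using Suc.IH[of k "b i"] lowdeg_error_le_square[OF assms, of d k "b i"] Suc
      by (simp add: distrib_right)
    have "(\<Sum>i<n. influence n d (\<lambda>x. f (i # x))) =
        real n * influence n d (avg n f) + (\<Sum>i<n. influence n d (b i))"
      unfolding b_def using n by (intro sum_influence assms) (simp add: avg_def)
    then have infl: "influence n (Suc d) f = influence n d (avg n f) +
        (\<Sum>i<n. influence n d (b i) + gmean n d (\<lambda>x. (b i x)\<^sup>2)) / real n"
      using n by (simp add: b_def sum.distrib add_divide_distrib)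
    have "real j * lowdeg_error n (Suc d) j f =
        real j * lowdeg_error n d j (avg n f) + (\<Sum>i<n. real j * lowdeg_error n d k (b i)) / real n"
      unfolding lowdeg_error_Suc[OF assms] b_def
      by (simp add: Suc distrib_left sum_distrib_left)
    also have "\<dots> \<le> influence n (Suc d) f"
      unfolding infl using n
      by (intro add_mono Suc.IH divide_right_mono sum_mono step) simp
    finally show ?thesis .
  qed
qed

subsection \<open>Monotone functions have small influence\<close>

text \<open>The mean of \<open>sgn (i - k)\<close> over uniform \<open>k < n\<close>, for
  \<open>i < n\<close>: a centred linear function of the index with values between -1 and 1.\<close>

definition slope :: "nat \<Rightarrow> nat \<Rightarrow> real" where
  "slope n i = (2 * real i + 1 - real n) / real n"

lemma sum_sgn_diff:
  assumes "i < n"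
  shows "(\<Sum>k<n. sgn (real i - real k)) = 2 * real i + 1 - real n"
  using assms
proof (induction n)
  case (Suc n)
  show ?case
  proof (cases "i = n")
    case True
    have "(\<Sum>k<n. sgn (real n - real k)) = (\<Sum>k<n. 1)"
      by (intro sum.cong) auto
    with True show ?thesis by simp
  next
    case False
    with Suc show ?thesis by simp
  qed
qed simp

lemma sum_slope: "(\<Sum>i<n. slope n i) = 0"
proof -
  \<comment> \<open>The upper limit is separated from \<open>n\<close> so that the induction leaves
    the summand fixed.\<close>
  have "(\<Sum>i<m. 2 * real i + 1 - real n) = real m * (real m - real n)" for m
    by (induction m) (simp_all add: algebra_simps)
  then show ?thesis
    by (simp add: slope_def sum_divide_distrib[symmetric])
qed

lemma slope_square_le:
  assumes "i < n"
  shows "(slope n i)\<^sup>2 \<le> 1"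
proof -
  have "\<bar>slope n i\<bar> \<le> 1"
    using assms by (auto simp: slope_def abs_le_iff field_simps)
  then show ?thesis by (simp add: abs_square_le_1)
qed

text \<open>For two independent uniform indices,
  \<open>(u i - u k)\<^sup>2 \<le> \<bar>u i - u k\<bar> = (u i - u k) sgn (i - k)\<close>; averaging gives the variance on the left and a
  correlation with a linear function on the right.\<close>
lemma variance_le_slope:
  fixes u :: "nat \<Rightarrow> real"
  assumes mono: "\<And>i k. i \<le> k \<Longrightarrow> k < n \<Longrightarrow> u i \<le> u k"
    and unit: "\<And>i. i < n \<Longrightarrow> 0 \<le> u i \<and> u i \<le> 1"
    and a: "(\<Sum>i<n. u i) = real n * a" and n: "n \<ge> 1"
  shows "(\<Sum>i<n. (u i - a)\<^sup>2) \<le> (\<Sum>i<n. u i * slope n i)"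
proof -
  have swap: "(\<Sum>i<n. \<Sum>k<n. u k * sgn (real i - real k)) = - (\<Sum>i<n. \<Sum>k<n. u i * sgn (real i - real k))"
  proof -
    have "(\<Sum>i<n. \<Sum>k<n. u k * sgn (real i - real k)) = (\<Sum>k<n. \<Sum>i<n. u k * sgn (real i - real k))"
      by (rule sum.swap)
    also have "\<dots> = (\<Sum>k<n. \<Sum>i<n. - (u k * sgn (real k - real i)))"
      by (intro sum.cong refl) (auto simp: sgn_if)
    finally show ?thesis by (simp add: sum_negf)
  qed
  have "2 * real n * (\<Sum>i<n. (u i - a)\<^sup>2) = 2 * real n * (\<Sum>i<n. (u i)\<^sup>2) - 2 * (real n * a)\<^sup>2"
    using sum_square_deviations[OF a] by (simp add: power2_eq_square algebra_simps)
  also have "\<dots> = (\<Sum>i<n. \<Sum>k<n. (u i - u k)\<^sup>2)"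
  proof -
    have "(\<Sum>k<n. (u i - u k)\<^sup>2) = real n * (u i)\<^sup>2 + (\<Sum>k<n. (u k)\<^sup>2) - (2 * (real n * a)) * u i" for i
      by (simp add: power2_diff sum.distrib sum_subtractf a[symmetric] sum_distrib_left[symmetric]
          sum_distrib_right[symmetric])
    then show ?thesis
      by (simp add: sum.distrib sum_subtractf a sum_distrib_left[symmetric])
         (simp add: power2_eq_square algebra_simps)
  qed
  also have "\<dots> \<le> (\<Sum>i<n. \<Sum>k<n. (u i - u k) * sgn (real i - real k))"
  proof (intro sum_mono)
    fix i k assume "i \<in> {..<n}" "k \<in> {..<n}"
    then have le: "\<bar>u i - u k\<bar> \<le> 1" and "(u i - u k) * sgn (real i - real k) = \<bar>u i - u k\<bar>"
      using unit[of i] unit[of k] mono[of i k] mono[of k i] by (auto simp: sgn_if)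
    moreover have "\<bar>u i - u k\<bar> * \<bar>u i - u k\<bar> \<le> 1 * \<bar>u i - u k\<bar>"
      using le by (intro mult_right_mono) auto
    ultimately show "(u i - u k)\<^sup>2 \<le> (u i - u k) * sgn (real i - real k)"
      by (simp add: power2_eq_square)
  qed
  also have "\<dots> = 2 * (\<Sum>i<n. u i * (\<Sum>k<n. sgn (real i - real k)))"
    by (simp add: left_diff_distrib sum_subtractf swap sum_distrib_left)
  also have "\<dots> = 2 * real n * (\<Sum>i<n. u i * slope n i)"
    using n by (simp add: sum_sgn_diff slope_def sum_distrib_left)
  finally show ?thesis using n by simp
qed

definition linear_form :: "nat \<Rightarrow> nat list \<Rightarrow> real" where
  "linear_form n x = sum_list (map (slope n) x)"

text \<open>The slopes of the coordinates are independent with mean zero and variance at most 1, so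
  the variances add up; the cross term vanishes by \<open>sum_slope\<close>.\<close>

lemma gmean_linear_form_square:
  assumes "n \<ge> 1"
  shows "gmean n d (\<lambda>x. (linear_form n x)\<^sup>2) \<le> real d"
proof (induction d)
  case 0
  show ?case by (simp add: linear_form_def)
next
  case (Suc d)
  have "gmean n (Suc d) (\<lambda>x. (linear_form n x)\<^sup>2) =
      (\<Sum>i<n. (slope n i)\<^sup>2 + (2 * gmean n d (linear_form n)) * slope n i +
        gmean n d (\<lambda>x. (linear_form n x)\<^sup>2)) / real n"
  proof -
    have square: "(linear_form n (i # x))\<^sup>2 =
        (slope n i)\<^sup>2 + (2 * slope n i) * linear_form n x + (linear_form n x)\<^sup>2" for i x
      by (simp add: linear_form_def power2_sum)
    show ?thesis
      unfolding gmean_Suc square gmean_add gmean_cmult gmean_const[OF assms] by (simp add: mult_ac)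
  qed
  also have "\<dots> = (\<Sum>i<n. (slope n i)\<^sup>2) / real n + gmean n d (\<lambda>x. (linear_form n x)\<^sup>2)"
    using assms by (simp add: sum.distrib sum_distrib_left[symmetric] sum_slope add_divide_distrib)
  also have "(\<Sum>i<n. (slope n i)\<^sup>2) / real n \<le> 1"
    using sum_mono[of "{..<n}" "\<lambda>i. (slope n i)\<^sup>2" "\<lambda>_. 1"] slope_square_le assms by simp
  finally show ?case using Suc by simp
qed

lemma slice_monotone: "monotone_grid n (Suc d) f \<Longrightarrow> i < n \<Longrightarrow> monotone_grid n d (\<lambda>x. f (i # x))"
  by (simp add: monotone_grid_def coord_le_def)

lemma slice_unit: "unit_valued n (Suc d) f \<Longrightarrow> i < n \<Longrightarrow> unit_valued n d (\<lambda>x. f (i # x))"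
  by (simp add: unit_valued_def)

text \<open>\<open>variance_le_slope\<close> on every line in a coordinate direction bounds that
  coordinate's influence by a correlation with its slope; summing over coordinates collects the
  slopes into \<open>linear_form\<close>.\<close>

lemma influence_le_linear_form:
  assumes "n \<ge> 1" "unit_valued n d f" "monotone_grid n d f"
  shows "influence n d f \<le> gmean n d (\<lambda>x. f x * linear_form n x)"
  using assms(2,3)
proof (induction d arbitrary: f)
  case 0
  show ?case by (simp add: linear_form_def)
next
  case (Suc d)
  have n: "real n > 0" using assms(1) by simp
  have "(\<Sum>i<n. gmean n d (\<lambda>x. (f (i # x) - avg n f x)\<^sup>2)) \<le>
      (\<Sum>i<n. gmean n d (\<lambda>x. f (i # x) * slope n i))"
    unfolding gmean_sum[symmetric]
  proof (rule gmean_mono, rule variance_le_slope[OF _ _ _ assms(1)])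
    fix x i k assume x: "x \<in> grid n d" and "i \<le> k" "k < n"
    then have "i # x \<in> grid n (Suc d)" "k # x \<in> grid n (Suc d)" "coord_le (i # x) (k # x)"
      by (auto simp: coord_le_def intro: list_all2_refl)
    then show "f (i # x) \<le> f (k # x)"
      using Suc.prems(2) unfolding monotone_grid_def by blast
  next
    fix x i assume "x \<in> grid n d" "i < n"
    then show "0 \<le> f (i # x) \<and> f (i # x) \<le> 1"
      using Suc.prems(1) by (simp add: unit_valued_def)
  next
    fix x
    show "(\<Sum>i<n. f (i # x)) = real n * avg n f x"
      using n by (simp add: avg_def)
  qed
  moreover have "(\<Sum>i<n. influence n d (\<lambda>x. f (i # x))) \<le>
      (\<Sum>i<n. gmean n d (\<lambda>x. f (i # x) * linear_form n x))"
    using Suc.prems by (intro sum_mono Suc.IH slice_unit slice_monotone) auto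
  ultimately have "influence n (Suc d) f \<le> (\<Sum>i<n. gmean n d (\<lambda>x. f (i # x) * slope n i)) / real n +
      (\<Sum>i<n. gmean n d (\<lambda>x. f (i # x) * linear_form n x)) / real n"
    by (simp add: add_mono divide_right_mono)
  also have "\<dots> = gmean n (Suc d) (\<lambda>x. f x * linear_form n x)"
    unfolding gmean_Suc add_divide_distrib[symmetric] sum.distrib[symmetric] gmean_add[symmetric]
    by (simp add: linear_form_def distrib_left)
  finally show ?case .
qed

text \<open>Cauchy-Schwarz between \<open>f\<close>, of norm at most 1, and the linear form, of norm
  at most \<open>sqrt d\<close>. It is carried out pointwise as an AM-GM inequality with weight
  \<open>s = sqrt d\<close>.\<close>

lemma influence_monotone_le:
  assumes "n \<ge> 1" "d \<ge> 1" "unit_valued n d f" "monotone_grid n d f"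
  shows "influence n d f \<le> sqrt (real d)"
proof -
  define s where "s = sqrt (real d)"
  have s: "s > 0" and ss: "s * s = real d" using assms(2) by (auto simp: s_def)
  have "f x * linear_form n x \<le> s / 2 + 1 / (2 * s) * (linear_form n x)\<^sup>2" if "x \<in> grid n d" for x
  proof -
    have "(f x)\<^sup>2 \<le> 1"
      using assms(3) that by (simp add: unit_valued_def abs_square_le_1)
    then have "s\<^sup>2 * (f x)\<^sup>2 \<le> s\<^sup>2 * 1" by (intro mult_left_mono) auto
    moreover have "0 \<le> (s * f x - linear_form n x)\<^sup>2" by simp
    ultimately have "2 * s * (f x * linear_form n x) \<le> s\<^sup>2 + (linear_form n x)\<^sup>2"
      by (simp add: power2_diff power_mult_distrib)
    then have "f x * linear_form n x \<le> (s\<^sup>2 + (linear_form n x)\<^sup>2) / (2 * s)"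
      using s by (simp add: pos_le_divide_eq mult.commute)
    also have "\<dots> = s / 2 + 1 / (2 * s) * (linear_form n x)\<^sup>2"
      using s by (simp add: add_divide_distrib power2_eq_square)
    finally show ?thesis .
  qed
  then have "influence n d f \<le> gmean n d (\<lambda>x. s / 2 + 1 / (2 * s) * (linear_form n x)\<^sup>2)"
    by (intro order_trans[OF influence_le_linear_form[OF assms(1,3,4)] gmean_mono])
  also have "\<dots> \<le> s / 2 + 1 / (2 * s) * real d"
    unfolding gmean_add gmean_cmult gmean_const[OF assms(1)]
    using gmean_linear_form_square[OF assms(1)] s by (intro add_left_mono mult_left_mono) auto
  also have "\<dots> = s" using s by (simp flip: ss)
  finally show ?thesis by (simp add: s_def)
qed

text \<open>Influence at most \<open>sqrt d\<close> leaves squared norm at most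
  \<open>r\<^sup>2\<close> in degrees from \<open>j\<close> on, and the mean of an absolute value is
  at most the root mean square, here again by AM-GM.\<close>

lemma L1_dist_lowdeg_le:
  assumes "n \<ge> 1" "d \<ge> 1" "unit_valued n d f" "monotone_grid n d f"
    and "r > 0" "sqrt (real d) / r\<^sup>2 \<le> real j"
  shows "L1_dist n d f (lowdeg n j f) \<le> r"
proof -
  have "0 < sqrt (real d) / r\<^sup>2" using assms(2,5) by simp
  then have j: "real j > 0" using assms(6) by linarith
  have "real j * lowdeg_error n d j f \<le> sqrt (real d)"
    using lowdeg_error_le_influence[OF assms(1)] influence_monotone_le[OF assms(1-4)] by (rule order_trans)
  also have "\<dots> \<le> real j * r\<^sup>2"
    using assms(5,6) by (simp add: field_simps)
  finally have e: "lowdeg_error n d j f \<le> r\<^sup>2" using j by simp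
  have abs_le: "\<bar>t\<bar> \<le> r / 2 + 1 / (2 * r) * t\<^sup>2" for t :: real
  proof -
    have "\<bar>t\<bar> * (2 * r) \<le> r\<^sup>2 + t\<^sup>2"
      using zero_le_power2[of "\<bar>t\<bar> - r"] by (simp add: power2_diff)
    then have "\<bar>t\<bar> \<le> (r\<^sup>2 + t\<^sup>2) / (2 * r)"
      using assms(5) by (simp add: pos_le_divide_eq)
    also have "\<dots> = r / 2 + 1 / (2 * r) * t\<^sup>2"
      using assms(5) by (simp add: add_divide_distrib power2_eq_square)
    finally show ?thesis .
  qed
  have "L1_dist n d f (lowdeg n j f) \<le> gmean n d (\<lambda>x. r / 2 + 1 / (2 * r) * (f x - lowdeg n j f x)\<^sup>2)"
    unfolding L1_dist_gmean by (intro gmean_mono abs_le)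
  also have "\<dots> \<le> r / 2 + 1 / (2 * r) * r\<^sup>2"
    unfolding gmean_add gmean_cmult gmean_const[OF assms(1)]
    using e assms(5) by (intro add_left_mono mult_left_mono) (auto simp: lowdeg_error_def)
  also have "\<dots> = r" using assms(5) by (simp add: power2_eq_square)
  finally show ?thesis .
qed

subsection \<open>A net for truncated block functions\<close>

definition block_const :: "nat \<Rightarrow> nat \<Rightarrow> nat \<Rightarrow> (nat list \<Rightarrow> real) \<Rightarrow> bool" where
  "block_const w n d f = (\<forall>x\<in>grid n d. \<forall>y\<in>grid n d.
     map (\<lambda>i. i div w) x = map (\<lambda>i. i div w) y \<longrightarrow> f x = f y)"

text \<open>This is the sum of \<open>(d choose i) * m ^ i\<close> over \<open>i < j\<close>: one
  scalar for each set of fewer than \<open>j\<close> coordinates together with a block index in each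
  of them. The recursion follows that of \<open>lowdeg\<close>.\<close>

fun num_coeffs :: "nat \<Rightarrow> nat \<Rightarrow> nat \<Rightarrow> nat" where
  "num_coeffs m d 0 = 0"
| "num_coeffs m 0 (Suc j) = 1"
| "num_coeffs m (Suc d) (Suc j) = num_coeffs m d (Suc j) + m * num_coeffs m d j"

lemma num_coeffs_le_power_dim: "num_coeffs m d j \<le> (1 + m) ^ d"
proof (induction m d j rule: num_coeffs.induct)
  case (3 m d j)
  have "num_coeffs m (Suc d) (Suc j) \<le> (1 + m) ^ d + m * (1 + m) ^ d"
    unfolding num_coeffs.simps using 3 by (intro add_mono mult_left_mono) auto
  then show ?case by simp
qed simp_all

text \<open>For part (ii): the exponent is the degree, which may be far below the dimension.\<close>

lemma num_coeffs_le_power_deg: "num_coeffs m d j \<le> (1 + d * m) ^ j"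
proof (induction m d j rule: num_coeffs.induct)
  case (3 m d j)
  have "num_coeffs m (Suc d) (Suc j) \<le> (1 + d * m) ^ Suc j + m * (1 + d * m) ^ j"
    unfolding num_coeffs.simps using 3 by (intro add_mono mult_left_mono) auto
  also have "\<dots> = (1 + Suc d * m) * (1 + d * m) ^ j"
    by (simp add: algebra_simps)
  also have "\<dots> \<le> (1 + Suc d * m) * (1 + Suc d * m) ^ j"
    by (intro mult_left_mono power_mono) auto
  finally show ?case by simp
qed simp_all

lemma interval_net:
  fixes M \<delta> :: real
  assumes "0 \<le> M" "0 < \<delta>" "M / \<delta> + 1 \<le> real K"
  obtains A where "finite A" "card A \<le> K" "\<And>t. \<bar>t\<bar> \<le> M \<Longrightarrow> \<exists>a\<in>A. \<bar>t - a\<bar> \<le> \<delta>"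
proof
  define A where "A = (\<lambda>i. 2 * \<delta> * real i - M) ` {..<K}"
  show "finite A" by (simp add: A_def)
  show "card A \<le> K" unfolding A_def using card_image_le[of "{..<K}"] by simp
  fix t assume t: "\<bar>t\<bar> \<le> M"
  define u where "u = (t + M) / (2 * \<delta>)"
  \<comment> \<open>Nearest-integer rounding of \<open>u\<close>, the position of \<open>t\<close>
    on a scale of mesh \<open>2 * \<delta>\<close> starting at \<open>-M\<close>.\<close>
  define i where "i = nat \<lfloor>u + 1 / 2\<rfloor>"
  have u: "0 \<le> u" "u \<le> M / \<delta>"
    using t assms(2) by (auto simp: u_def field_simps)
  then have i: "real i \<le> u + 1 / 2" "u + 1 / 2 < real i + 1"
    by (simp_all add: i_def)
  then have "real i < real K" using u assms(3) by linarith
  then have "2 * \<delta> * real i - M \<in> A" by (auto simp: A_def)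
  moreover have "\<bar>u - real i\<bar> \<le> 1 / 2" using i by linarith
  then have "2 * \<delta> * \<bar>u - real i\<bar> \<le> \<delta>" using assms(2) by simp
  then have "\<bar>2 * \<delta> * (u - real i)\<bar> \<le> \<delta>" using assms(2) by (simp add: abs_mult)
  then have "\<bar>t - (2 * \<delta> * real i - M)\<bar> \<le> \<delta>"
    using assms(2) by (simp add: u_def right_diff_distrib add.commute diff_diff_eq2)
  ultimately show "\<exists>a\<in>A. \<bar>t - a\<bar> \<le> \<delta>" by blast
qed

lemma abs_avg_le:
  assumes "n \<ge> 1" "\<And>i. i < n \<Longrightarrow> \<bar>f (i # x)\<bar> \<le> M"
  shows "\<bar>avg n f x\<bar> \<le> M"
proof -
  have "\<bar>\<Sum>i<n. f (i # x)\<bar> \<le> (\<Sum>i<n. M)"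
    using assms(2) by (intro order_trans[OF sum_abs] sum_mono) auto
  then show ?thesis using assms(1) by (simp add: avg_def field_simps)
qed

text \<open>The factor \<open>4\<^sup>d\<close>: each coordinate halves the precision, and passing from \<open>f\<close> to
  \<open>f (i # x) - avg n f x\<close> doubles the bound.\<close>
lemma lowdeg_net:
  assumes "n \<ge> 1" "w \<ge> 1" "\<And>i. i < n \<Longrightarrow> i div w < m"
    and "0 \<le> M" "0 < \<delta>" "4 ^ d * (M / \<delta> + 1) \<le> real K"
  shows "\<exists>N. finite N \<and> card N \<le> K ^ num_coeffs m d j \<and>
    (\<forall>f. (\<forall>x\<in>grid n d. \<bar>f x\<bar> \<le> M) \<longrightarrow> block_const w n d f \<longrightarrow>
      (\<exists>p\<in>N. \<forall>x\<in>grid n d. \<bar>lowdeg n j f x - p x\<bar> \<le> \<delta>))"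
  using assms(4-6)
proof (induction d arbitrary: j M \<delta>)
  case 0
  then have "M / \<delta> + 1 \<le> real K" by simp
  with 0 obtain A where A: "finite A" "card A \<le> K"
      "\<And>t. \<bar>t\<bar> \<le> M \<Longrightarrow> \<exists>a\<in>A. \<bar>t - a\<bar> \<le> \<delta>"
    using interval_net by blast
  show ?case
  proof (cases j)
    case 0
    with \<open>0 < \<delta>\<close> show ?thesis
      by (intro exI[of _ "{\<lambda>x::nat list. 0::real}"]) simp
  next
    case (Suc k)
    have "card ((\<lambda>a x. a) ` A) \<le> K"
      using A by (metis card_image_le order_trans)
    with A Suc show ?thesis
      by (intro exI[of _ "(\<lambda>a x. a) ` A"]) auto
  qed
next
  case (Suc d)
  show ?case
  proof (cases j)
    case 0
    with Suc.prems show ?thesis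
      by (intro exI[of _ "{\<lambda>x::nat list. 0::real}"]) (simp add: lowdeg_0 del: lowdeg.simps)
  next
    case j: (Suc k)
    have "4 ^ d * (M / (\<delta> / 2) + 1) \<le> 4 ^ Suc d * (M / \<delta> + 1)"
    proof -
      have "0 \<le> M / \<delta>" using Suc.prems by simp
      then have "M / (\<delta> / 2) + 1 \<le> 4 * (M / \<delta> + 1)" by simp
      then have "4 ^ d * (M / (\<delta> / 2) + 1) \<le> 4 ^ d * (4 * (M / \<delta> + 1))" by (intro mult_left_mono) auto
      then show ?thesis by simp
    qed
    then have "4 ^ d * (M / (\<delta> / 2) + 1) \<le> real K"
      using Suc.prems(3) by (rule order_trans)
    from Suc.IH[OF Suc.prems(1) half_gt_zero[OF Suc.prems(2)] this, of j]
    obtain N1 where N1: "finite N1" "card N1 \<le> K ^ num_coeffs m d j"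
      "\<And>f. \<forall>x\<in>grid n d. \<bar>f x\<bar> \<le> M \<Longrightarrow> block_const w n d f \<Longrightarrow>
        \<exists>p\<in>N1. \<forall>x\<in>grid n d. \<bar>lowdeg n j f x - p x\<bar> \<le> \<delta> / 2"
      by blast
    \<comment> \<open>The deviations are bounded by \<open>2 * M\<close> and get precision
      \<open>\<delta> / 2\<close>, so their ratio grows by exactly the factor 4 that one dimension
      provides.\<close>
    have "4 ^ d * (2 * M / (\<delta> / 2) + 1) \<le> 4 ^ Suc d * (M / \<delta> + 1)"
    proof -
      have "2 * M / (\<delta> / 2) + 1 \<le> 4 * (M / \<delta> + 1)" by simp
      then have "4 ^ d * (2 * M / (\<delta> / 2) + 1) \<le> 4 ^ d * (4 * (M / \<delta> + 1))" by (intro mult_left_mono) auto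
      then show ?thesis by simp
    qed
    then have "4 ^ d * (2 * M / (\<delta> / 2) + 1) \<le> real K"
      using Suc.prems(3) by (rule order_trans)
    from Suc.IH[OF _ half_gt_zero[OF Suc.prems(2)] this, of k] Suc.prems(1)
    obtain N2 where N2: "finite N2" "card N2 \<le> K ^ num_coeffs m d k"
      "\<And>f. \<forall>x\<in>grid n d. \<bar>f x\<bar> \<le> 2 * M \<Longrightarrow> block_const w n d f \<Longrightarrow>
        \<exists>p\<in>N2. \<forall>x\<in>grid n d. \<bar>lowdeg n k f x - p x\<bar> \<le> \<delta> / 2"
      by auto
    \<comment> \<open>A member of the net combines one approximation \<open>p\<close> of the
      averaged part with one approximation of the deviation for each of the \<open>m\<close> blocks
      of the first coordinate.\<close>
    define G where "G = (\<lambda>(p, q) x. p (tl x) + q (hd x div w) (tl x) :: real)"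
    define N where "N = G ` (N1 \<times> (\<Pi>\<^sub>E c\<in>{..<m}. N2))"
    have fin: "finite (N1 \<times> (\<Pi>\<^sub>E c\<in>{..<m}. N2))"
      using N1 N2 by (intro finite_cartesian_product finite_PiE) auto
    have "card N \<le> card N1 * card N2 ^ m"
      unfolding N_def using card_image_le[OF fin, of G] by (simp add: card_cartesian_product card_PiE)
    also have "\<dots> \<le> K ^ num_coeffs m d j * (K ^ num_coeffs m d k) ^ m"
      using N1 N2 by (intro mult_mono power_mono) auto
    also have "\<dots> = K ^ num_coeffs m (Suc d) j"
      by (simp add: j power_add power_mult[symmetric] mult.commute)
    finally have card: "card N \<le> K ^ num_coeffs m (Suc d) j" .
    have "\<exists>p\<in>N. \<forall>x\<in>grid n (Suc d). \<bar>lowdeg n j f x - p x\<bar> \<le> \<delta>"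
      if bound: "\<forall>x\<in>grid n (Suc d). \<bar>f x\<bar> \<le> M" and bc: "block_const w n (Suc d) f" for f
    proof -
      define b where "b i x = f (i # x) - avg n f x" for i x
      have slice: "f (i # x) = f (i' # x')"
        if "i < n" "i' < n" "x \<in> grid n d" "x' \<in> grid n d" "i div w = i' div w"
          "map (\<lambda>i. i div w) x = map (\<lambda>i. i div w) x'" for i i' x x'
      proof -
        have "i # x \<in> grid n (Suc d)" "i' # x' \<in> grid n (Suc d)" using that by auto
        moreover have "map (\<lambda>i. i div w) (i # x) = map (\<lambda>i. i div w) (i' # x')"
          using that by simp
        ultimately show ?thesis using bc unfolding block_const_def by blast
      qed
      have avg_le: "\<bar>avg n f x\<bar> \<le> M" if "x \<in> grid n d" for x
        using bound that assms(1) by (intro abs_avg_le) auto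
      have avg_block: "avg n f x = avg n f x'"
        if "x \<in> grid n d" "x' \<in> grid n d" "map (\<lambda>i. i div w) x = map (\<lambda>i. i div w) x'" for x x'
      proof -
        have "(\<Sum>i<n. f (i # x)) = (\<Sum>i<n. f (i # x'))"
          using that by (intro sum.cong slice) auto
        then show ?thesis by (simp add: avg_def)
      qed
      have "\<forall>x\<in>grid n d. \<bar>avg n f x\<bar> \<le> M" using avg_le by blast
      moreover have "block_const w n d (avg n f)"
        unfolding block_const_def by (intro ballI impI avg_block)
      ultimately obtain p where p: "p \<in> N1" "\<And>x. x \<in> grid n d \<Longrightarrow> \<bar>lowdeg n j (avg n f) x - p x\<bar> \<le> \<delta> / 2"
        using N1(3)[of "avg n f"] by blast
      have b_net: "\<exists>q\<in>N2. \<forall>x\<in>grid n d. \<bar>lowdeg n k (b i) x - q x\<bar> \<le> \<delta> / 2" if i: "i < n" for i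
      proof (rule N2(3))
        show "\<forall>x\<in>grid n d. \<bar>b i x\<bar> \<le> 2 * M"
        proof
          fix x assume "x \<in> grid n d"
          then have "\<bar>f (i # x)\<bar> \<le> M" "\<bar>avg n f x\<bar> \<le> M" using bound i avg_le by auto
          then show "\<bar>b i x\<bar> \<le> 2 * M" unfolding b_def by linarith
        qed
        show "block_const w n d (b i)"
          unfolding block_const_def b_def
          by (intro ballI impI arg_cong2[where f = "(-)"] slice[OF i i] avg_block) simp_all
      qed
      \<comment> \<open>Block \<open>c\<close> is represented by its first index
        \<open>c * w\<close>. If that lies outside the grid, any member of \<open>N2\<close> will
        do; one exists because index 0 is always available.\<close>
      have "\<exists>q\<in>N2. c * w < n \<longrightarrow> (\<forall>x\<in>grid n d. \<bar>lowdeg n k (b (c * w)) x - q x\<bar> \<le> \<delta> / 2)" for c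
      proof (cases "c * w < n")
        case True
        then show ?thesis using b_net by blast
      next
        case False
        moreover have "0 < n" using assms(1) by simp
        ultimately show ?thesis using b_net[of 0] by blast
      qed
      then have "\<forall>c. \<exists>q. q \<in> N2 \<and>
          (c * w < n \<longrightarrow> (\<forall>x\<in>grid n d. \<bar>lowdeg n k (b (c * w)) x - q x\<bar> \<le> \<delta> / 2))"
        by blast
      from choice[OF this] obtain q where q: "\<And>c. q c \<in> N2"
        "\<And>c x. c * w < n \<Longrightarrow> x \<in> grid n d \<Longrightarrow> \<bar>lowdeg n k (b (c * w)) x - q c x\<bar> \<le> \<delta> / 2"
        by blast
      define P where "P = G (p, restrict q {..<m})"
      have "P \<in> N" unfolding P_def N_def using p q by (intro imageI) auto
      moreover have "\<bar>lowdeg n j f x - P x\<bar> \<le> \<delta>" if "x \<in> grid n (Suc d)" for x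
      proof -
        from that obtain i y where x: "x = i # y" "i < n" "y \<in> grid n d" by (rule grid_SucE)
        \<comment> \<open>The first index of the block of \<open>i\<close>; its deviation agrees
          with that of \<open>i\<close> on the grid, so the approximation chosen for the block
          serves \<open>i\<close> too.\<close>
        define i' where "i' = i div w * w"
        have "i' \<le> i" "i' div w = i div w" using assms(2) by (auto simp: i'_def)
        with x have i': "i' < n" "i' div w = i div w" by auto
        have "lowdeg n k (b i) y = lowdeg n k (b i') y"
          unfolding b_def
          by (intro lowdeg_cong arg_cong2[where f = "(-)"] slice) (use x i' in auto)
        then have "\<bar>lowdeg n k (b i) y - q (i div w) y\<bar> \<le> \<delta> / 2"
          using q(2)[of "i div w" y] i' x by (simp add: i'_def)
        moreover have "\<bar>lowdeg n j (avg n f) y - p y\<bar> \<le> \<delta> / 2" using p x by blast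
        moreover have "lowdeg n j f x - P x =
            (lowdeg n j (avg n f) y - p y) + (lowdeg n k (b i) y - q (i div w) y)"
          using x assms(3) by (simp add: P_def G_def j b_def[abs_def])
        ultimately show ?thesis by linarith
      qed
      ultimately show ?thesis by blast
    qed
    with card fin show ?thesis
      by (intro exI[of _ N]) (simp add: N_def)
  qed
qed

subsection \<open>Coarsening to blocks\<close>

text \<open>The minimum with \<open>n - 1\<close> is there because the last block may be cut off by
  the edge of the grid.\<close>

definition block_top :: "nat \<Rightarrow> nat \<Rightarrow> nat list \<Rightarrow> nat list" where
  "block_top w n = map (\<lambda>i. min (n - 1) (i div w * w + (w - 1)))"

lemma block_top_in_grid: "n \<ge> 1 \<Longrightarrow> x \<in> grid n d \<Longrightarrow> block_top w n x \<in> grid n d"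
  by (auto simp: block_top_def in_grid_iff)

lemma block_top_mono: "coord_le x y \<Longrightarrow> coord_le (block_top w n x) (block_top w n y)"
  unfolding coord_le_def block_top_def list_all2_map1 list_all2_map2
  by (erule list_all2_mono) (intro min.mono add_mono mult_right_mono div_le_mono, auto)

lemma le_block_top:
  assumes "w \<ge> 1" "x \<in> grid n d"
  shows "coord_le x (block_top w n x)"
proof -
  have "i \<le> min (n - 1) (i div w * w + (w - 1))" if "i < n" for i
  proof -
    have "i mod w \<le> w - 1" using assms(1) mod_less_divisor[of w i] by linarith
    then have "i \<le> i div w * w + (w - 1)" using div_mult_mod_eq[of i w] by linarith
    with that show ?thesis by simp
  qed
  with assms(2) show ?thesis
    by (auto simp: coord_le_def block_top_def list_all2_conv_all_nth in_grid_iff)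
qed

lemma block_top_le_shift:
  "coord_le (block_top w n x) (map (\<lambda>i. i + (w - 1)) x)"
  by (auto simp: coord_le_def block_top_def list_all2_conv_all_nth intro!: min.coboundedI2)

text \<open>The diagonal shift is injective, so the shifted values sum to at most the total of
  \<open>g\<close>. Points that may leave the grid are given the largest possible value 1, and their
  number is the error term.\<close>

lemma sum_shift_le:
  assumes "k < n" "unit_valued n d g"
  shows "(\<Sum>x\<in>grid n d. if x \<in> grid (n - k) d then g (map (\<lambda>i. i + k) x) else 1) \<le>
    (\<Sum>x\<in>grid n d. g x) + (real (n ^ d) - real ((n - k) ^ d))"
proof -
  define S where "S = grid (n - k) d"
  have sub: "S \<subseteq> grid n d" by (force simp: S_def in_grid_iff)
  have fin: "finite S" by (simp add: S_def)
  have inj: "inj_on (map (\<lambda>i. i + k)) S"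
    by (auto simp: inj_on_def intro: map_inj_on[where f = "\<lambda>i. i + k"])
  have "(\<Sum>x\<in>grid n d. if x \<in> S then g (map (\<lambda>i. i + k) x) else 1) =
      (\<Sum>x\<in>S. g (map (\<lambda>i. i + k) x)) + (\<Sum>x\<in>grid n d - S. 1)"
    using sub by (subst sum.subset_diff[of S]) (auto simp: add.commute)
  also have "(\<Sum>x\<in>S. g (map (\<lambda>i. i + k) x)) = (\<Sum>x\<in>map (\<lambda>i. i + k) ` S. g x)"
    using inj by (simp add: sum.reindex)
  also have "\<dots> \<le> (\<Sum>x\<in>grid n d. g x)"
  proof (rule sum_mono2)
    show "map (\<lambda>i. i + k) ` S \<subseteq> grid n d" by (force simp: S_def in_grid_iff)
  qed (use assms(2) in \<open>auto simp: unit_valued_def\<close>)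
  also have "(\<Sum>x\<in>grid n d - S. 1) = real (n ^ d) - real ((n - k) ^ d)"
    using sub fin by (simp add: card_Diff_subset S_def of_nat_diff power_mono)
  finally show ?thesis by (simp add: S_def)
qed

text \<open>By monotonicity \<open>g \<circ> block_top w n\<close> lies between \<open>g\<close> and
  its diagonal shift \<open>G\<close>, so the distance is at most a difference of means. That is
  \<open>1 - (1 - k/n)^d\<close> at most, and Bernoulli's inequality finishes.\<close>

lemma L1_dist_block_top:
  assumes "n \<ge> 1" "m \<ge> 1" "unit_valued n d g" "monotone_grid n d g" "w = (n - 1) div m + 1"
  shows "L1_dist n d g (g \<circ> block_top w n) \<le> real d / real m"
proof -
  \<comment> \<open>The width \<open>w\<close> is \<open>n / m\<close> rounded up and may exceed
    \<open>n / m\<close>; the shift needed is only \<open>w - 1\<close>, which does not.\<close>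
  define k where "k = w - 1"
  have k: "k = (n - 1) div m" by (simp add: k_def assms(5))
  have w: "w \<ge> 1" by (simp add: assms(5))
  have "k * m \<le> n - 1" by (simp add: k)
  then have km: "real k * real m \<le> real n" using assms(1) by (simp flip: of_nat_mult)
  have "k \<le> n - 1" by (simp add: k)
  then have kn: "k < n" using assms(1) by linarith
  define G where "G x = (if x \<in> grid (n - k) d then g (map (\<lambda>i. i + k) x) else 1)" for x
  have "\<bar>g x - g (block_top w n x)\<bar> \<le> G x - g x" if x: "x \<in> grid n d" for x
  proof -
    have top: "block_top w n x \<in> grid n d" using assms(1) x by (rule block_top_in_grid)
    have "g x \<le> g (block_top w n x)"
      using assms(4) x top le_block_top[OF w x] unfolding monotone_grid_def by blast
    moreover have "g (block_top w n x) \<le> G x"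
    proof (cases "x \<in> grid (n - k) d")
      case True
      then have "map (\<lambda>i. i + k) x \<in> grid n d" by (auto simp: in_grid_iff)
      then show ?thesis
        using True assms(4) top block_top_le_shift[of w n x]
        unfolding monotone_grid_def G_def k_def by auto
    next
      case False
      then show ?thesis using assms(3) top by (simp add: G_def unit_valued_def)
    qed
    ultimately show ?thesis by linarith
  qed
  then have "L1_dist n d g (g \<circ> block_top w n) \<le> gmean n d (\<lambda>x. G x - g x)"
    unfolding L1_dist_gmean by (intro gmean_mono) simp
  also have "\<dots> \<le> (real (n ^ d) - real ((n - k) ^ d)) / real (n ^ d)"
    using sum_shift_le[OF kn assms(3)]
    by (simp add: gmean_def G_def sum_subtractf divide_right_mono)
  also have "\<dots> = 1 - (1 + (- real k / real n)) ^ d"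
  proof -
    have "1 + (- real k / real n) = real (n - k) / real n"
      using kn by (simp add: of_nat_diff field_simps)
    then show ?thesis
      using assms(1) by (simp add: diff_divide_distrib power_divide)
  qed
  also have "\<dots> \<le> real d * (real k / real n)"
    using Bernoulli_inequality[of "- real k / real n" d] kn by simp
  also have "real k / real n \<le> 1 / real m"
    using km assms(1,2) by (simp add: field_simps)
  finally show ?thesis by (simp add: mult_left_mono)
qed

lemma div_block_width_less:
  fixes i n m :: nat
  assumes "i < n" "m \<ge> 1"
  shows "i div ((n - 1) div m + 1) < m"
proof (rule less_mult_imp_div_less)
  have "n - 1 < m * ((n - 1) div m + 1)"
    using dividend_less_times_div[of m "n - 1"] assms(2) by simp
  with assms(1) show "i < m * ((n - 1) div m + 1)" by linarith
qed

subsection \<open>Testing by sampling against a net\<close>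

text \<open>\<open>[]\<close> is the dummy value outside the index range; the product form supplies
  the independence for Hoeffding.\<close>

definition sample_pmf :: "nat \<Rightarrow> nat \<Rightarrow> nat \<Rightarrow> (nat \<Rightarrow> nat list) pmf" where
  "sample_pmf n d s = Pi_pmf {..<s} [] (\<lambda>_. pmf_of_set (grid n d))"

lemma grid_nonempty: "n \<ge> 1 \<Longrightarrow> grid n d \<noteq> {}"
  using card_grid[of n d] by (metis card.empty not_one_le_zero power_eq_0_iff)

lemma sample_in_grid:
  assumes "n \<ge> 1" "\<omega> \<in> set_pmf (sample_pmf n d s)" "i < s"
  shows "\<omega> i \<in> grid n d"
  using assms grid_nonempty[OF assms(1), of d]
  by (auto simp: sample_pmf_def set_Pi_pmf PiE_dflt_def)

lemma sample_Hoeffding: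
  assumes "n \<ge> 1" "s \<ge> 1" "\<delta> \<ge> 0" "\<And>x. x \<in> grid n d \<Longrightarrow> 0 \<le> \<phi> x \<and> \<phi> x \<le> 1"
  shows "measure_pmf.prob (sample_pmf n d s)
      {\<omega>. (\<Sum>i<s. \<phi> (\<omega> i)) \<ge> real s * (gmean n d \<phi> + \<delta>)} \<le> exp (- 2 * real s * \<delta>\<^sup>2)" (is ?upper)
    and "measure_pmf.prob (sample_pmf n d s)
      {\<omega>. (\<Sum>i<s. \<phi> (\<omega> i)) \<le> real s * (gmean n d \<phi> - \<delta>)} \<le> exp (- 2 * real s * \<delta>\<^sup>2)" (is ?lower)
proof -
  let ?P = "sample_pmf n d s"
  have expect: "measure_pmf.expectation ?P (\<lambda>\<omega>. \<phi> (\<omega> i)) = gmean n d \<phi>" if "i < s" for i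
  proof -
    have "measure_pmf.expectation ?P (\<lambda>\<omega>. \<phi> (\<omega> i)) =
        measure_pmf.expectation (map_pmf (\<lambda>\<omega>. \<omega> i) ?P) \<phi>"
      by simp
    also have "map_pmf (\<lambda>\<omega>. \<omega> i) ?P = pmf_of_set (grid n d)"
      using that by (simp add: sample_pmf_def Pi_pmf_component)
    also have "measure_pmf.expectation \<dots> \<phi> = gmean n d \<phi>"
      using grid_nonempty[OF assms(1)] by (simp add: integral_pmf_of_set gmean_def)
    finally show ?thesis .
  qed
  interpret H: Hoeffding_ineq "measure_pmf ?P" "{..<s}" "\<lambda>i \<omega>. \<phi> (\<omega> i)" "\<lambda>_. 0" "\<lambda>_. 1"
    "\<Sum>i<s. measure_pmf.expectation ?P (\<lambda>\<omega>. \<phi> (\<omega> i))"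
  proof unfold_locales
    show "prob_space.indep_vars (measure_pmf ?P) (\<lambda>_. borel) (\<lambda>i \<omega>. \<phi> (\<omega> i)) {..<s}"
      unfolding sample_pmf_def
      by (intro prob_space.indep_vars_compose2[OF _ indep_vars_Pi_pmf])
         (auto simp: measure_pmf.prob_space_axioms)
    show "AE \<omega> in measure_pmf ?P. \<phi> (\<omega> i) \<in> {0..1}" if "i \<in> {..<s}" for i
      using that assms(4) sample_in_grid[OF assms(1)] by (auto simp: AE_measure_pmf_iff)
  qed auto
  have mu: "(\<Sum>i<s. measure_pmf.expectation ?P (\<lambda>\<omega>. \<phi> (\<omega> i))) = real s * gmean n d \<phi>"
    by (simp add: expect)
  have e: "- 2 * (real s * \<delta>)\<^sup>2 / (\<Sum>i<s. (1 - 0)\<^sup>2) = - 2 * real s * \<delta>\<^sup>2"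
    using assms(2) by (simp add: power2_eq_square)
  have pos: "0 < (\<Sum>i<s. (1 - 0 :: real)\<^sup>2)" "0 \<le> real s * \<delta>" using assms(2,3) by auto
  show ?upper ?lower
    using H.Hoeffding_ineq_ge[OF pos(2,1)] H.Hoeffding_ineq_le[OF pos(2,1)]
    unfolding mu e by (simp_all add: distrib_left right_diff_distrib)
qed

lemma L1_mono_le:
  assumes "unit_valued n d g" "monotone_grid n d g"
  shows "L1_mono n d f \<le> L1_dist n d f g"
  unfolding L1_mono_def using assms
  by (intro cInf_lower) (auto intro!: bdd_belowI[of _ 0] L1_dist_nonneg)

text \<open>The infimum is only approached here, whence the strict inequality and the strict gap
  assumed in \<open>tester_of_net\<close>.\<close>

lemma L1_mono_less_witness:
  assumes "L1_mono n d f < c"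
  obtains g where "unit_valued n d g" "monotone_grid n d g" "L1_dist n d f g < c"
proof -
  have "L1_dist n d f (\<lambda>_. 0) \<in> {L1_dist n d f g | g. unit_valued n d g \<and> monotone_grid n d g}"
    by (auto simp: unit_valued_def monotone_grid_def)
  then have "{L1_dist n d f g | g. unit_valued n d g \<and> monotone_grid n d g} \<noteq> {}" by blast
  from cInf_lessD[OF this] assms that show ?thesis
    unfolding L1_mono_def by blast
qed

text \<open>If \<open>f\<close> is close, one suitable net member has to pass the empirical test. If
  \<open>f\<close> is far, every member must fail, being monotone and hence far from
  \<open>f\<close>; only this case needs the union bound.\<close>

lemma tester_of_net:
  fixes N :: "(nat list \<Rightarrow> real) set"
  assumes n: "n \<ge> 1" and N: "finite N" "\<And>p. p \<in> N \<Longrightarrow> unit_valued n d p \<and> monotone_grid n d p"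
    and net: "\<And>g. unit_valued n d g \<Longrightarrow> monotone_grid n d g \<Longrightarrow> \<exists>p\<in>N. L1_dist n d g p \<le> r"
    and gap: "0 < \<delta>" "r + 2 * \<delta> < eps2 - eps1"
    and s: "1 \<le> s" "real s \<le> q" "ln (3 * real (card N)) / (2 * \<delta>\<^sup>2) \<le> real s"
  shows "\<exists>T. nonadaptive_tolerant_L1_tester n d eps1 eps2 q T"
proof -
  \<comment> \<open>The threshold leaves a margin \<open>\<delta>\<close> on both sides: far
    functions have distance at least \<open>\<tau> + \<delta>\<close> to every member, close ones
    less than \<open>\<tau> - \<delta>\<close> to some member.\<close>
  define \<tau> where "\<tau> = eps2 - \<delta>"
  define P where "P = sample_pmf n d s"
  \<comment> \<open>The decision rule may depend on the sample \<open>\<omega>\<close>, since it is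
    drawn jointly with the query list and sees only the answers.\<close>
  define D where "D \<omega> ys \<longleftrightarrow> (\<exists>p\<in>N. (\<Sum>i<s. \<bar>ys ! i - p (\<omega> i)\<bar>) \<le> real s * \<tau>)"
    for \<omega> :: "nat \<Rightarrow> nat list" and ys
  define T where "T = map_pmf (\<lambda>\<omega>. (map \<omega> [0..<s], D \<omega>)) P"
  have "unit_valued n d (\<lambda>_. 0)" "monotone_grid n d (\<lambda>_. 0)"
    by (simp_all add: unit_valued_def monotone_grid_def)
  from net[OF this] have "card N > 0" using N(1) by (auto simp: card_gt_0_iff)
  have "ln (3 * real (card N)) \<le> 2 * real s * \<delta>\<^sup>2"
    using s(3) gap(1) by (simp add: pos_divide_le_eq mult_ac)
  then have "exp (ln (3 * real (card N))) \<le> exp (2 * real s * \<delta>\<^sup>2)" by simp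
  \<comment> \<open>The size of \<open>s\<close> is made for this union bound; as \<open>N\<close>
    is nonempty, it covers a single member as well.\<close>
  then have tail: "real (card N) * exp (- 2 * real s * \<delta>\<^sup>2) \<le> 1 / 3"
    using \<open>card N > 0\<close> by (simp add: exp_minus field_simps)
  have "1 * exp (- 2 * real s * \<delta>\<^sup>2) \<le> real (card N) * exp (- 2 * real s * \<delta>\<^sup>2)"
    using \<open>card N > 0\<close> by (intro mult_right_mono) auto
  with tail have tail1: "exp (- 2 * real s * \<delta>\<^sup>2) \<le> 1 / 3" by linarith
  have accept: "accept_prob T f =
      measure_pmf.prob P {\<omega>. \<exists>p\<in>N. (\<Sum>i<s. \<bar>f (\<omega> i) - p (\<omega> i)\<bar>) \<le> real s * \<tau>}" for f
    unfolding accept_prob_def T_def measure_map_pmf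
    by (intro arg_cong[where f = "measure_pmf.prob P"]) (auto simp: D_def)
  have bounded: "0 \<le> \<bar>f x - p x\<bar> \<and> \<bar>f x - p x\<bar> \<le> 1"
    if "unit_valued n d f" "p \<in> N" "x \<in> grid n d" for f p x
  proof -
    have "0 \<le> f x \<and> f x \<le> 1" "0 \<le> p x \<and> p x \<le> 1"
      using that N(2) unfolding unit_valued_def by blast+
    then show ?thesis by linarith
  qed
  have "accept_prob T f \<ge> 2 / 3" if f: "unit_valued n d f" "L1_mono n d f \<le> eps1" for f
  proof -
    have "L1_mono n d f < eps2 - r - 2 * \<delta>" using f(2) gap(2) by linarith
    then obtain g where g: "unit_valued n d g" "monotone_grid n d g" "L1_dist n d f g < eps2 - r - 2 * \<delta>"
      by (rule L1_mono_less_witness)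
    from net[OF g(1,2)] obtain p where p: "p \<in> N" "L1_dist n d g p \<le> r" by blast
    then have "L1_dist n d f p < \<tau> - \<delta>"
      using g(3) L1_dist_triangle[of n d f p g] by (simp add: \<tau>_def)
    then have "real s * (gmean n d (\<lambda>x. \<bar>f x - p x\<bar>) + \<delta>) \<le> real s * \<tau>"
      by (intro mult_left_mono) (auto simp: L1_dist_gmean)
    then have "1 - accept_prob T f \<le> measure_pmf.prob P
        {\<omega>. (\<Sum>i<s. \<bar>f (\<omega> i) - p (\<omega> i)\<bar>) \<ge> real s * (gmean n d (\<lambda>x. \<bar>f x - p x\<bar>) + \<delta>)}"
      unfolding accept measure_pmf.prob_compl[symmetric, simplified]
      using p(1) by (intro measure_pmf.finite_measure_mono) force+
    also have "\<dots> \<le> exp (- 2 * real s * \<delta>\<^sup>2)"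
      unfolding P_def using n s(1) gap(1) bounded[OF f(1) p(1)] by (intro sample_Hoeffding(1)) auto
    finally show ?thesis using tail1 by linarith
  qed
  moreover have "1 - accept_prob T f \<ge> 2 / 3" if f: "unit_valued n d f" "L1_mono n d f \<ge> eps2" for f
  proof -
    let ?E = "\<lambda>p. {\<omega>. (\<Sum>i<s. \<bar>f (\<omega> i) - p (\<omega> i)\<bar>) \<le> real s * \<tau>}"
    have E: "measure_pmf.prob P (?E p) \<le> exp (- 2 * real s * \<delta>\<^sup>2)" if p: "p \<in> N" for p
    proof -
      have "eps2 \<le> L1_dist n d f p"
        using f(2) N(2)[OF p] L1_mono_le order_trans by blast
      then have "real s * \<tau> \<le> real s * (gmean n d (\<lambda>x. \<bar>f x - p x\<bar>) - \<delta>)"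
        by (intro mult_left_mono) (auto simp: L1_dist_gmean \<tau>_def)
      then have "measure_pmf.prob P (?E p) \<le> measure_pmf.prob P
          {\<omega>. (\<Sum>i<s. \<bar>f (\<omega> i) - p (\<omega> i)\<bar>) \<le> real s * (gmean n d (\<lambda>x. \<bar>f x - p x\<bar>) - \<delta>)}"
        by (intro measure_pmf.finite_measure_mono) auto
      also have "\<dots> \<le> exp (- 2 * real s * \<delta>\<^sup>2)"
        unfolding P_def using n s(1) gap(1) bounded[OF f(1) p] by (intro sample_Hoeffding(2)) auto
      finally show ?thesis .
    qed
    have "accept_prob T f = measure_pmf.prob P (\<Union>p\<in>N. ?E p)"
      unfolding accept by (intro arg_cong[where f = "measure_pmf.prob P"]) auto
    also have "\<dots> \<le> (\<Sum>p\<in>N. measure_pmf.prob P (?E p))"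
      using N(1) by (intro measure_pmf.finite_measure_subadditive_finite) auto
    also have "\<dots> \<le> real (card N) * exp (- 2 * real s * \<delta>\<^sup>2)"
      using sum_bounded_above[of N "\<lambda>p. measure_pmf.prob P (?E p)"] E by blast
    finally show ?thesis using tail by linarith
  qed
  moreover have "\<forall>(Q, D)\<in>set_pmf T. real (length Q) \<le> q \<and> set Q \<subseteq> grid n d"
    using s(2) sample_in_grid[OF n] by (auto simp: T_def P_def)
  ultimately show ?thesis
    unfolding nonadaptive_tolerant_L1_tester_def by (intro exI[of _ T]) blast
qed

subsection \<open>Query complexity\<close>

text \<open>Three errors add up: coarsening to blocks, truncation \<open>r\<close>, and precision
  \<open>\<delta>\<close> of the net for truncated block functions.\<close>

lemma monotone_net:
  assumes "n \<ge> 1" "m \<ge> 1" "0 < \<delta>" "4 ^ d * (1 / \<delta> + 1) \<le> real K"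
    and lowdeg: "\<And>h. unit_valued n d h \<Longrightarrow> monotone_grid n d h \<Longrightarrow> L1_dist n d h (lowdeg n j h) \<le> r"
  shows "\<exists>N. finite N \<and> card N \<le> K ^ num_coeffs m d j \<and>
    (\<forall>p\<in>N. unit_valued n d p \<and> monotone_grid n d p) \<and>
    (\<forall>g. unit_valued n d g \<longrightarrow> monotone_grid n d g \<longrightarrow>
      (\<exists>p\<in>N. L1_dist n d g p \<le> 2 * (real d / real m + r + \<delta>)))"
proof -
  define w where "w = (n - 1) div m + 1"
  define R where "R = real d / real m + r + \<delta>"
  have "i div w < m" if "i < n" for i
    unfolding w_def using that assms(2) by (rule div_block_width_less)
  from lowdeg_net[OF assms(1) _ this zero_le_one assms(3,4), of j]
  obtain N0 where N0: "finite N0" "card N0 \<le> K ^ num_coeffs m d j"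
    "\<And>f. \<forall>x\<in>grid n d. \<bar>f x\<bar> \<le> 1 \<Longrightarrow> block_const w n d f \<Longrightarrow>
      \<exists>p\<in>N0. \<forall>x\<in>grid n d. \<bar>lowdeg n j f x - p x\<bar> \<le> \<delta>"
    unfolding w_def by auto
  have external: "\<exists>p\<in>N0. L1_dist n d g p \<le> R" if g: "unit_valued n d g" "monotone_grid n d g" for g
  proof -
    define h where "h = g \<circ> block_top w n"
    have unit: "unit_valued n d h"
      using g(1) block_top_in_grid[OF assms(1)] by (simp add: h_def unit_valued_def)
    have mono: "monotone_grid n d h"
      using g(2) block_top_in_grid[OF assms(1)] block_top_mono by (simp add: h_def monotone_grid_def)
    \<comment> \<open>\<open>block_top\<close> factors through the block indices, which makes
      \<open>h\<close> constant on blocks.\<close>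
    have top: "block_top w n x = map (\<lambda>c. min (n - 1) (c * w + (w - 1))) (map (\<lambda>i. i div w) x)" for x
      by (simp add: block_top_def)
    have "block_const w n d h"
      by (auto simp only: block_const_def h_def o_apply top)
    moreover have "\<forall>x\<in>grid n d. \<bar>h x\<bar> \<le> 1"
      using unit by (simp add: unit_valued_def)
    ultimately obtain p where p: "p \<in> N0" "\<And>x. x \<in> grid n d \<Longrightarrow> \<bar>lowdeg n j h x - p x\<bar> \<le> \<delta>"
      using N0(3) by blast
    have "L1_dist n d (lowdeg n j h) p \<le> gmean n d (\<lambda>_. \<delta>)"
      unfolding L1_dist_gmean using p(2) by (rule gmean_mono)
    then have "L1_dist n d (lowdeg n j h) p \<le> \<delta>"
      by (simp add: gmean_const[OF assms(1)])
    moreover have "L1_dist n d g h \<le> real d / real m"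
      unfolding h_def using assms(1,2) g w_def by (rule L1_dist_block_top)
    ultimately have "L1_dist n d g p \<le> R"
      using lowdeg[OF unit mono] L1_dist_triangle[of n d g p h]
        L1_dist_triangle[of n d h p "lowdeg n j h"] unfolding R_def by linarith
    with p(1) show ?thesis by blast
  qed
  \<comment> \<open>The members of \<open>N0\<close> need not be monotone; replacing them by monotone functions nearby doubles the
    radius.\<close>
  define good where "good p g \<longleftrightarrow> unit_valued n d g \<and> monotone_grid n d g \<and> L1_dist n d g p \<le> R" for p g
  define sel where "sel p = (SOME g. good p g)" for p
  have sel: "good p (sel p)" if "good p g" for p g
    unfolding sel_def using someI[of "good p"] that by blast
  define N where "N = sel ` {p \<in> N0. \<exists>g. good p g}"
  show ?thesis
  proof (intro exI[of _ N] conjI ballI allI impI)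
    show "finite N" using N0(1) by (simp add: N_def)
    have "card N \<le> card {p \<in> N0. \<exists>g. good p g}"
      unfolding N_def using N0(1) by (intro card_image_le) simp
    also have "\<dots> \<le> card N0" using N0(1) by (intro card_mono) auto
    finally show "card N \<le> K ^ num_coeffs m d j" using N0(2) by simp
    show "unit_valued n d p" "monotone_grid n d p" if "p \<in> N" for p
      using that sel unfolding N_def good_def by blast+
    show "\<exists>p\<in>N. L1_dist n d g p \<le> 2 * (real d / real m + r + \<delta>)"
      if g: "unit_valued n d g" "monotone_grid n d g" for g
    proof -
      from external[OF g] obtain p where p: "p \<in> N0" "L1_dist n d g p \<le> R" by blast
      with g have "good p g" by (simp add: good_def)
      then have "good p (sel p)" "sel p \<in> N" using sel p(1) by (auto simp: N_def)
      then show ?thesis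
        using p(2) L1_dist_triangle[of n d g "sel p" p] L1_dist_commute[of n d p "sel p"]
        by (intro bexI[of _ "sel p"]) (auto simp: good_def R_def)
    qed
  qed
qed

lemma tester_of_lowdeg:
  assumes "n \<ge> 1" "m \<ge> 1" "0 < \<delta>" "4 ^ d * (1 / \<delta> + 1) \<le> real K"
    and "\<And>h. unit_valued n d h \<Longrightarrow> monotone_grid n d h \<Longrightarrow> L1_dist n d h (lowdeg n j h) \<le> r"
    and gap: "2 * (real d / real m + r + \<delta>) + 2 * \<delta> < eps2 - eps1"
    and q: "1 + (real (num_coeffs m d j) * ln (real K) + ln 3) / (2 * \<delta>\<^sup>2) \<le> q"
  shows "\<exists>T. nonadaptive_tolerant_L1_tester n d eps1 eps2 q T"
proof -
  obtain N where N: "finite N" "card N \<le> K ^ num_coeffs m d j"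
    "\<And>p. p \<in> N \<Longrightarrow> unit_valued n d p \<and> monotone_grid n d p"
    "\<And>g. unit_valued n d g \<Longrightarrow> monotone_grid n d g \<Longrightarrow>
      \<exists>p\<in>N. L1_dist n d g p \<le> 2 * (real d / real m + r + \<delta>)"
    using monotone_net[OF assms(1-5)] by blast
  have "0 < 4 ^ d * (1 / \<delta> + 1)" using assms(3) by (simp add: add_pos_pos)
  then have K: "0 < real K" using assms(4) by linarith
  have "unit_valued n d (\<lambda>_. 0)" "monotone_grid n d (\<lambda>_. 0)"
    by (simp_all add: unit_valued_def monotone_grid_def)
  from N(4)[OF this] have "card N > 0" using N(1) by (auto simp: card_gt_0_iff)
  have "real (card N) \<le> real K ^ num_coeffs m d j"
    using N(2) by (simp flip: of_nat_power)
  then have "ln (real (card N)) \<le> real (num_coeffs m d j) * ln (real K)"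
    using \<open>card N > 0\<close> K by (simp flip: ln_realpow)
  then have "ln (3 * real (card N)) \<le> real (num_coeffs m d j) * ln (real K) + ln 3"
    using \<open>card N > 0\<close> by (simp add: ln_mult)
  then have ln_le: "ln (3 * real (card N)) / (2 * \<delta>\<^sup>2) \<le>
      (real (num_coeffs m d j) * ln (real K) + ln 3) / (2 * \<delta>\<^sup>2)"
    by (intro divide_right_mono) auto
  \<comment> \<open>The sample size is \<open>t\<close> rounded up. Since \<open>t > 0\<close> it is
    at least 1, and the summand 1 in the bound on \<open>q\<close> absorbs the rounding.\<close>
  define t where "t = ln (3 * real (card N)) / (2 * \<delta>\<^sup>2)"
  have "0 < ln (3 * real (card N))" using \<open>card N > 0\<close> by (intro ln_gt_zero) linarith
  then have "0 < t" using assms(3) by (simp add: t_def)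
  then have "1 \<le> nat \<lceil>t\<rceil>" "t \<le> real (nat \<lceil>t\<rceil>)" "real (nat \<lceil>t\<rceil>) \<le> t + 1" by linarith+
  moreover have "t + 1 \<le> q" using ln_le q by (simp add: t_def)
  ultimately show ?thesis
    using tester_of_net[OF assms(1) N(1,3,4) assms(3) gap, of "nat \<lceil>t\<rceil>" q] by (simp add: t_def)
qed

text \<open>Parameters: degree \<open>d + 1\<close>, so no truncation error;
  \<open>d / m \<le> \<epsilon> / 3\<close>; precision \<open>\<epsilon> / 24\<close>. The gap
  condition then uses 5/6 of \<open>\<epsilon>\<close>.\<close>

lemma tester_grid:
  fixes eps1 eps2 :: real and d :: nat
  defines "\<epsilon> \<equiv> eps2 - eps1"
  defines "B \<equiv> (1 / \<epsilon>\<^sup>2) * (5 * real d / \<epsilon>) ^ d"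
  assumes "n \<ge> 1" "d \<ge> 1" "0 < \<epsilon>" "\<epsilon> \<le> 1"
  shows "\<exists>T. nonadaptive_tolerant_L1_tester n d eps1 eps2 (1153 * B * ln (2 + B)) T"
proof -
  define A where "A = (5 * real d / \<epsilon>) ^ d"
  define L where "L = ln (2 + B)"
  \<comment> \<open>With rounding, \<open>1 + m\<close> is at most
    \<open>3 * d / \<epsilon> + 2\<close>, hence at most \<open>5 * d / \<epsilon>\<close>: this is
    the base of the power in the bound.\<close>
  define m where "m = nat \<lceil>3 * real d / \<epsilon>\<rceil>"
  define K where "K = nat \<lceil>4 ^ d * (24 / \<epsilon> + 1)\<rceil>"
  have d: "1 \<le> real d" using assms(4) by simp
  have de: "real d \<le> real d / \<epsilon>" "1 / \<epsilon> \<le> real d / \<epsilon>" "1 \<le> 1 / \<epsilon>"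
    using d assms(5,6) by (simp_all add: pos_le_divide_eq divide_right_mono mult_left_le)
  have m_ge: "3 * real d / \<epsilon> \<le> real m" unfolding m_def by linarith
  moreover have "real m \<le> 3 * real d / \<epsilon> + 1"
    unfolding m_def using de d by linarith
  ultimately have "1 \<le> real m" and m_le: "1 + real m \<le> 5 * real d / \<epsilon>"
    using de d by linarith+
  then have m: "m \<ge> 1" and "0 < real m" by linarith+
  then have m_inv: "real d / real m \<le> \<epsilon> / 3"
    using m_ge assms(5) by (simp add: pos_divide_le_eq mult.commute)
  have "real (num_coeffs m d (d + 1)) \<le> (1 + real m) ^ d"
    using num_coeffs_le_power_dim[of m d "d + 1"] by (simp flip: of_nat_le_iff[where 'a = real])
  also have "\<dots> \<le> A" unfolding A_def using m_le by (intro power_mono) auto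
  finally have P: "real (num_coeffs m d (d + 1)) \<le> A" .
  have base: "5 / \<epsilon> \<le> 5 * real d / \<epsilon>" "5 \<le> 5 * real d / \<epsilon>" using de d by simp_all
  have A5: "5 ^ d \<le> A" unfolding A_def using base by (intro power_mono) auto
  have "5 / \<epsilon> \<le> A"
  proof -
    have "(5 * real d / \<epsilon>) ^ 1 \<le> A" unfolding A_def using base assms(4) by (intro power_increasing) auto
    with base show ?thesis by simp
  qed
  have BA: "B = A / \<epsilon>\<^sup>2" by (simp add: B_def A_def)
  have eps2_le: "\<epsilon>\<^sup>2 \<le> 1" using assms(5,6) by (simp add: power_le_one)
  have A_pos: "5 \<le> A" using \<open>5 / \<epsilon> \<le> A\<close> de by simp
  have "A \<le> B" unfolding BA using A_pos eps2_le assms(5) by (simp add: pos_le_divide_eq mult_left_le)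
  have "exp 1 \<le> (3::real)" by (rule exp_le)
  then have L1: "1 \<le> L"
    unfolding L_def using \<open>A \<le> B\<close> A_pos by (subst ln_ge_iff) auto
  have lnA: "ln A \<le> L" unfolding L_def using A_pos \<open>A \<le> B\<close> by simp
  have "real d * ln 4 \<le> real d * ln 5" by (intro mult_left_mono) auto
  also have "\<dots> = ln (5 ^ d)" by (simp add: ln_realpow)
  also have "\<dots> \<le> ln A" using A5 A_pos by simp
  finally have ln4: "real d * ln 4 \<le> L" using lnA by linarith
  \<comment> \<open>Splitting off \<open>5 / \<epsilon>\<close>, which is at most \<open>A\<close>,
    bounds the logarithm of the precision without any relation between \<open>d\<close> and
    \<open>1 / \<epsilon>\<close>.\<close>
  have "ln (26 / 5) \<le> L" unfolding L_def using A_pos \<open>A \<le> B\<close> by simp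
  moreover have "ln (5 / \<epsilon>) \<le> ln A" using \<open>5 / \<epsilon> \<le> A\<close> A_pos assms(5) by (subst ln_le_cancel_iff) auto
  moreover have "ln (26 / \<epsilon>) = ln (26 / 5) + ln (5 / \<epsilon>)"
    using ln_mult_pos[of "26 / 5" "5 / \<epsilon>"] assms(5) by simp
  ultimately have ln26: "ln (26 / \<epsilon>) \<le> 2 * L" using lnA by linarith
  have K_ge: "4 ^ d * (1 / (\<epsilon> / 24) + 1) \<le> real K"
    unfolding K_def using real_nat_ceiling_ge[of "4 ^ d * (24 / \<epsilon> + 1)"] by simp
  have "real K \<le> 4 ^ d * (24 / \<epsilon> + 1) + 1"
    unfolding K_def using assms(5) by simp
  also have "\<dots> \<le> 4 ^ d * (24 / \<epsilon> + 1) + 4 ^ d * 1" by simp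
  also have "\<dots> = 4 ^ d * (24 / \<epsilon> + 2)" by (simp add: algebra_simps)
  also have "\<dots> \<le> 4 ^ d * (26 / \<epsilon>)" using de by (intro mult_left_mono) auto
  finally have K_le: "real K \<le> 4 ^ d * (26 / \<epsilon>)" .
  have "0 < 4 ^ d * (1 / (\<epsilon> / 24) + 1)" using assms(5) by (simp add: add_pos_pos)
  then have K_pos: "0 < real K" using K_ge by linarith
  have "ln (real K) \<le> ln (4 ^ d * (26 / \<epsilon>))" using K_le K_pos by simp
  also have "\<dots> = real d * ln 4 + ln (26 / \<epsilon>)"
    using ln_mult_pos[of "4 ^ d" "26 / \<epsilon>"] assms(5) by (simp only: ln_realpow) simp
  also have "\<dots> \<le> 3 * L" using ln4 ln26 by linarith
  finally have lnK: "ln (real K) \<le> 3 * L" .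
  have "ln 3 \<le> L" unfolding L_def using A_pos \<open>A \<le> B\<close> by simp
  have "real (num_coeffs m d (d + 1)) * ln (real K) \<le> A * (3 * L)"
    using P lnK L1 A_pos by (intro order_trans[OF mult_left_mono[OF lnK] mult_right_mono[OF P]]) auto
  moreover have "1 * L \<le> A * L" using A_pos L1 by (intro mult_right_mono) auto
  ultimately have "real (num_coeffs m d (d + 1)) * ln (real K) + ln 3 \<le> 4 * (A * L)"
    using \<open>ln 3 \<le> L\<close> by linarith
  then have "(real (num_coeffs m d (d + 1)) * ln (real K) + ln 3) / (2 * (\<epsilon> / 24)\<^sup>2) \<le>
      4 * (A * L) / (2 * (\<epsilon> / 24)\<^sup>2)"
    by (intro divide_right_mono) auto
  \<comment> \<open>The constant is \<open>4 * 24\<^sup>2 / 2\<close>; one more copy of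
    \<open>B * L\<close> later pays for the rounding of the sample size.\<close>
  also have "\<dots> = 1152 * (B * L)" using assms(5) by (simp add: BA power_divide field_simps)
  finally have q: "(real (num_coeffs m d (d + 1)) * ln (real K) + ln 3) / (2 * (\<epsilon> / 24)\<^sup>2) \<le> 1152 * (B * L)" .
  have "1 * 1 \<le> B * L" using \<open>A \<le> B\<close> A_pos L1 by (intro mult_mono) auto
  with q have "1 + (real (num_coeffs m d (d + 1)) * ln (real K) + ln 3) / (2 * (\<epsilon> / 24)\<^sup>2) \<le>
      1153 * B * L" by linarith
  moreover have "L1_dist n d h (lowdeg n (d + 1) h) \<le> 0" for h
    by (simp add: L1_dist_def lowdeg_eq_self in_grid_iff)
  moreover have "2 * (real d / real m + 0 + \<epsilon> / 24) + 2 * (\<epsilon> / 24) < \<epsilon>"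
    using m_inv assms(5) by argo
  ultimately show ?thesis
    using assms(5) unfolding L_def \<epsilon>_def[symmetric]
    by (intro tester_of_lowdeg[OF assms(3) m _ K_ge, where j = "d + 1" and r = 0]) (simp_all add: \<epsilon>_def)
qed

text \<open>\<open>\<epsilon>\<close> is a free lower bound for the gap. Block error and truncation
  error are \<open>\<epsilon> / 8\<close> each and the precision is \<open>\<epsilon> / 16\<close>,
  so the gap condition uses 3/4 of \<open>\<epsilon>\<close>.\<close>

lemma tester_sqrt_dim:
  fixes eps1 eps2 \<epsilon> :: real and d :: nat
  defines "X \<equiv> sqrt (real d) / \<epsilon>\<^sup>2"
  assumes "n \<ge> 1" "d \<ge> 1" "0 < \<epsilon>" "\<epsilon> \<le> 1" "\<epsilon> \<le> eps2 - eps1"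
  shows "\<exists>T. nonadaptive_tolerant_L1_tester n d eps1 eps2 (2 powr (1066 * X * ln (2 + X))) T"
proof -
  \<comment> \<open>Both \<open>sqrt d\<close> and \<open>1 / \<epsilon>\<close> are at most
    \<open>X\<close>, so every quantity below is bounded by a power of \<open>Z\<close>; constants
    are absorbed using \<open>Z \<ge> 3\<close>.\<close>
  define Z where "Z = 2 + X"
  define m where "m = nat \<lceil>8 * real d / \<epsilon>\<rceil>"
  \<comment> \<open>\<open>64 * X\<close> equals \<open>sqrt d / (\<epsilon> / 8)\<^sup>2\<close>,
    the degree that truncation error \<open>\<epsilon> / 8\<close> requires.\<close>
  define j where "j = nat \<lceil>64 * X\<rceil>"
  define K where "K = nat \<lceil>4 ^ d * (16 / \<epsilon> + 1)\<rceil>"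
  have d: "1 \<le> real d" "1 \<le> sqrt (real d)" using assms(3) by simp_all
  have inv: "1 \<le> 1 / \<epsilon>" using assms(4,5) by simp
  have X_eq: "X = sqrt (real d) * (1 / \<epsilon>) * (1 / \<epsilon>)"
    by (simp add: X_def power2_eq_square)
  have "1 * 1 \<le> (1 / \<epsilon>) * (1 / \<epsilon>)" "1 * (1 / \<epsilon>) \<le> (1 / \<epsilon>) * (1 / \<epsilon>)"
    using inv assms(4) by (intro mult_mono; simp)+
  then have "sqrt (real d) * 1 \<le> X" "1 * (1 / \<epsilon>) \<le> X"
    unfolding X_eq mult.assoc using d inv assms(4) by (intro mult_mono; simp)+
  then have X: "sqrt (real d) \<le> X" "1 / \<epsilon> \<le> X" "1 \<le> X" using d by linarith+
  have "(sqrt (real d))\<^sup>2 \<le> X\<^sup>2" using X(1) by (intro power_mono) auto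
  then have d_le: "real d \<le> X\<^sup>2" by simp
  have Z: "3 \<le> Z" "X \<le> Z" using X by (simp_all add: Z_def)
  have d_eps: "1 \<le> real d / \<epsilon>"
    using mult_mono[of 1 "real d" 1 "1 / \<epsilon>"] d inv by simp
  have m_ge: "8 * real d / \<epsilon> \<le> real m" unfolding m_def by linarith
  have m_le: "real m \<le> 9 * (real d / \<epsilon>)" unfolding m_def using d_eps by linarith
  have "1 \<le> real m" using m_ge d_eps by linarith
  then have m: "m \<ge> 1" and "0 < real m" by linarith+
  then have m_inv: "real d / real m \<le> \<epsilon> / 8"
    using m_ge assms(4) by (simp add: pos_divide_le_eq mult.commute)
  have "1 + real (d * m) \<le> 1 + X\<^sup>2 * (9 * (X\<^sup>2 * X))"
  proof -
    have "real d * (1 / \<epsilon>) \<le> X\<^sup>2 * X" using d_le X assms(4) by (intro mult_mono) auto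
    then have "real m \<le> 9 * (X\<^sup>2 * X)" using m_le by simp
    then show ?thesis using d_le by (simp add: mult_mono)
  qed
  also have "\<dots> = 1 + 9 * X ^ 5" by (simp add: power_numeral_reduce)
  also have "\<dots> \<le> 10 * X ^ 5" using X(3) one_le_power[of X 5] by simp
  also have "\<dots> \<le> Z ^ 3 * Z ^ 5"
    using Z X power_mono[of 3 Z 3] by (intro mult_mono power_mono) auto
  finally have dm: "1 + real (d * m) \<le> Z ^ 8" by (simp flip: power_add)
  have j_ge: "64 * X \<le> real j" unfolding j_def by linarith
  have j_le: "real j \<le> 65 * X" unfolding j_def using X(3) by linarith
  have "real (num_coeffs m d j) \<le> (1 + real (d * m)) ^ j"
    using num_coeffs_le_power_deg[of m d j]
    by (simp flip: of_nat_le_iff[where 'a = real] of_nat_mult)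
  also have "\<dots> \<le> (Z ^ 8) ^ j" using dm by (intro power_mono) auto
  finally have P: "real (num_coeffs m d j) \<le> Z ^ (8 * j)" by (simp add: power_mult)
  have K_ge: "4 ^ d * (1 / (\<epsilon> / 16) + 1) \<le> real K"
    unfolding K_def using real_nat_ceiling_ge[of "4 ^ d * (16 / \<epsilon> + 1)"] by simp
  have "real K \<le> 4 ^ d * (16 / \<epsilon> + 1) + 1"
    unfolding K_def using assms(4) by simp
  also have "\<dots> \<le> 4 ^ d * (16 / \<epsilon> + 1) + 4 ^ d * 1" by simp
  also have "\<dots> = 4 ^ d * (16 / \<epsilon> + 2)" by (simp add: algebra_simps)
  also have "\<dots> \<le> 4 ^ d * (18 / \<epsilon>)" using inv by (intro mult_left_mono) auto
  finally have K_le: "real K \<le> 4 ^ d * (18 / \<epsilon>)" .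
  have "0 < 4 ^ d * (1 / (\<epsilon> / 16) + 1)" using assms(4) by (simp add: add_pos_pos)
  then have K_pos: "0 < real K" using K_ge by linarith
  have ln_self: "ln x \<le> x" if "0 < x" for x :: real
    using ln_le_minus_one[OF that] by simp
  have "ln (real K) \<le> ln (4 ^ d * (18 / \<epsilon>))" using K_le K_pos by simp
  also have "\<dots> = real d * ln 4 + ln (18 / \<epsilon>)"
    using ln_mult_pos[of "4 ^ d" "18 / \<epsilon>"] assms(4) by (simp only: ln_realpow) simp
  also have "\<dots> \<le> real d * 4 + 18 / \<epsilon>"
    using assms(4) by (intro add_mono mult_left_mono ln_self) auto
  also have "\<dots> \<le> 4 * Z\<^sup>2 + 18 * Z"
    using d_le X Z power_mono[OF Z(2), of 2] by linarith
  also have "\<dots> \<le> 10 * Z\<^sup>2"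
    using mult_right_mono[OF Z(1), of Z] Z by (simp add: power2_eq_square)
  also have "\<dots> \<le> Z ^ 3 * Z\<^sup>2"
    using Z power_mono[of 3 Z 3] by (intro mult_right_mono) auto
  finally have lnK: "ln (real K) \<le> Z ^ 5" by (simp flip: power_add)
  define W where "W = Z ^ (8 * j)"
  have W: "1 \<le> W" unfolding W_def using Z by (intro one_le_power) simp
  have Zpow: "1 \<le> Z ^ 5" using Z by (intro one_le_power) simp
  have "ln 3 \<le> (3::real)" by (rule ln_self) simp
  also have "\<dots> \<le> Z * 1" using Z by simp
  also have "\<dots> \<le> Z * Z ^ 4" using Z by (intro mult_left_mono one_le_power) auto
  finally have ln3: "ln 3 \<le> Z ^ 5" by (simp flip: power_Suc)
  have "real (num_coeffs m d j) * ln (real K) \<le> W * Z ^ 5"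
    unfolding W_def using P lnK Zpow Z by (intro order_trans[OF mult_left_mono[OF lnK] mult_right_mono[OF P]]) auto
  moreover have "1 * Z ^ 5 \<le> W * Z ^ 5" using W Zpow by (intro mult_right_mono) linarith+
  ultimately have num: "real (num_coeffs m d j) * ln (real K) + ln 3 \<le> 2 * (W * Z ^ 5)"
    using ln3 by linarith
  have den: "1 / (2 * (\<epsilon> / 16)\<^sup>2) \<le> 128 * Z\<^sup>2"
  proof -
    have "(1 / \<epsilon>)\<^sup>2 \<le> Z\<^sup>2" using X Z assms(4) by (intro power_mono) auto
    then show ?thesis by (simp add: power_divide)
  qed
  have "(real (num_coeffs m d j) * ln (real K) + ln 3) * (1 / (2 * (\<epsilon> / 16)\<^sup>2)) \<le>
      2 * (W * Z ^ 5) * (1 / (2 * (\<epsilon> / 16)\<^sup>2))"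
    using num by (intro mult_right_mono) auto
  also have "\<dots> \<le> 2 * (W * Z ^ 5) * (128 * Z\<^sup>2)"
    using den W Z by (intro mult_left_mono) auto
  also have "\<dots> = 256 * (W * Z ^ 7)" by (simp add: power_numeral_reduce)
  finally have q: "(real (num_coeffs m d j) * ln (real K) + ln 3) / (2 * (\<epsilon> / 16)\<^sup>2) \<le> 256 * (W * Z ^ 7)"
    by simp
  have "1 * 1 \<le> W * Z ^ 7" using W Z by (intro mult_mono one_le_power) auto
  with q have "1 + (real (num_coeffs m d j) * ln (real K) + ln 3) / (2 * (\<epsilon> / 16)\<^sup>2) \<le> 257 * (W * Z ^ 7)"
    by linarith
  \<comment> \<open>Here 257 is at most \<open>3 ^ 6\<close>. The final exponent has
    \<open>8 * j\<close> from the coefficients, 5 from \<open>ln K\<close>, 2 from the squared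
    precision and 6 from this constant.\<close>
  also have "\<dots> \<le> Z ^ 6 * (W * Z ^ 7)"
    using Z W power_mono[of 3 Z 6] by (intro mult_right_mono) auto
  also have "\<dots> = Z ^ (8 * j + 13)" by (simp add: W_def power_add power_numeral_reduce)
  also have "\<dots> = exp (real (8 * j + 13) * ln Z)"
    using Z by (simp add: exp_of_nat_mult del: of_nat_add of_nat_mult)
  \<comment> \<open>\<open>8 * j + 13\<close> is at most \<open>(8 * 65 + 13) * X = 533 * X\<close>,
    and passing to base 2 costs a factor 2 since \<open>2 * ln 2 \<ge> 1\<close>.\<close>
  also have "\<dots> \<le> exp (1066 * X * ln Z * ln 2)"
  proof -
    have "real (8 * j + 13) \<le> 533 * X" using j_le X(3) by simp
    also have "533 * X * 1 \<le> 533 * X * (2 * ln 2)"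
      using ln2_ge_two_thirds X(3) by (intro mult_left_mono) auto
    finally have "real (8 * j + 13) * ln Z \<le> (533 * X * (2 * ln 2)) * ln Z"
      using Z by (intro mult_right_mono) auto
    then show ?thesis by (simp add: mult_ac)
  qed
  also have "\<dots> = 2 powr (1066 * X * ln Z)" by (simp add: powr_def)
  finally have q: "1 + (real (num_coeffs m d j) * ln (real K) + ln 3) / (2 * (\<epsilon> / 16)\<^sup>2) \<le>
    2 powr (1066 * X * ln Z)" .
  have "sqrt (real d) / (\<epsilon> / 8)\<^sup>2 \<le> real j" using j_ge by (simp add: X_def power_divide mult.commute)
  then have "L1_dist n d h (lowdeg n j h) \<le> \<epsilon> / 8" if "unit_valued n d h" "monotone_grid n d h" for h
    using that assms(4) by (intro L1_dist_lowdeg_le[OF assms(2,3)]) auto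
  moreover have "2 * (real d / real m + \<epsilon> / 8 + \<epsilon> / 16) + 2 * (\<epsilon> / 16) < eps2 - eps1"
    using m_inv assms(4,6) by argo
  ultimately show ?thesis
    using q assms(4) unfolding Z_def
    by (intro tester_of_lowdeg[OF assms(2) m _ K_ge, where j = j and r = "\<epsilon> / 8"]) simp_all
qed

theorem theorem1p9:
  shows
  "(\<exists>C k. C > 0 \<and> (\<forall>(n::nat) (d::nat) (eps1::real) eps2.
      1 \<le> n \<longrightarrow> 1 \<le> d \<longrightarrow> 0 \<le> eps1 \<longrightarrow> eps1 < eps2 \<longrightarrow> eps2 \<le> 1 \<longrightarrow>
      (let B = (1 / (eps2 - eps1)^2) * (5 * real d / (eps2 - eps1)) ^ d in
       \<exists>T. nonadaptive_tolerant_L1_tester n d eps1 eps2 (C * B * (ln (2 + B)) ^ k) T))) \<and>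
   (\<exists>C k. C > 0 \<and> (\<forall>(n::nat) (d::nat) (eps1::real) eps2.
      1 \<le> n \<longrightarrow> 1 \<le> d \<longrightarrow> 0 \<le> 3 * eps1 \<longrightarrow> 3 * eps1 < eps2 \<longrightarrow> eps2 \<le> 1 \<longrightarrow>
      (let X = sqrt (real d) / (eps2 - 3 * eps1)^2 in
       \<exists>T. nonadaptive_tolerant_L1_tester n d eps1 eps2 (2 powr (C * X * (ln (2 + X)) ^ k)) T)))"
proof (intro conjI)
  show "\<exists>C k. C > 0 \<and> (\<forall>(n::nat) (d::nat) (eps1::real) eps2.
      1 \<le> n \<longrightarrow> 1 \<le> d \<longrightarrow> 0 \<le> eps1 \<longrightarrow> eps1 < eps2 \<longrightarrow> eps2 \<le> 1 \<longrightarrow>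
      (let B = (1 / (eps2 - eps1)^2) * (5 * real d / (eps2 - eps1)) ^ d in
       \<exists>T. nonadaptive_tolerant_L1_tester n d eps1 eps2 (C * B * (ln (2 + B)) ^ k) T))"
    unfolding Let_def
    by (rule exI[of _ 1153], rule exI[of _ 1]) (use tester_grid in simp)
  show "\<exists>C k. C > 0 \<and> (\<forall>(n::nat) (d::nat) (eps1::real) eps2.
      1 \<le> n \<longrightarrow> 1 \<le> d \<longrightarrow> 0 \<le> 3 * eps1 \<longrightarrow> 3 * eps1 < eps2 \<longrightarrow> eps2 \<le> 1 \<longrightarrow>
      (let X = sqrt (real d) / (eps2 - 3 * eps1)^2 in
       \<exists>T. nonadaptive_tolerant_L1_tester n d eps1 eps2 (2 powr (C * X * (ln (2 + X)) ^ k)) T))"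
    unfolding Let_def
    \<comment> \<open>The free parameter is \<open>eps2 - 3 * eps1\<close>, which is at most the
      true gap \<open>eps2 - eps1\<close> because \<open>eps1\<close> is nonnegative.\<close>
    by (rule exI[of _ 1066], rule exI[of _ 1]) (use tester_sqrt_dim in simp)
qed

end
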